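(* Let $\mathbb{H}_\infty=\{(z_1,z_2)\in\mathbb{C}^2 : |z_1|<e^{-1/|z_2|},\ z_2\in\mathbb{D}^*\}$ be the exponential Hartogs triangle, where $\mathbb{D}^*=\{z\in\mathbb{C}:0<|z|<1\}$. The operator $\mathbf{F}^2=\mathbf{F}\circ\mathbf{F}:H^\infty(\mathbb{H}_\infty)\to H^\infty(\mathbb{H}_\infty)$ is bounded.
   Context: For a bounded domain $\Omega\subset\mathbb{C}^n$, $\mathcal{O}(\Omega)$ is the space of holomorphic functions on $\Omega$, $A^2(\Omega)=L^2(\Omega)\cap\mathcal{O}(\Omega)$ (with respect to Lebesgue measure, with the $L^2$ norm), and $H^\infty(\Omega)=L^\infty(\Omega)\cap\mathcal{O}(\Omega)$ with the sup norm. The Bergman projection $\mathbf{B}$ is the orthogonal projection from $L^2(\Omega)$ onto $A^2(\Omega)$. The Friedrichs operator is the conjugate-linear map $\mathbf{F}:A^2(\Omega)\to A^2(\Omega)$, $\mathbf{F}(g)=\mathbf{B}(\overline{g})$. An operator $T:X\to Y$ is bounded if it maps $X$ into $Y$ with $\|Tx\|_Y\le C\|x\|_X$ for some constant $C$ and all $x\in X$. *)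

theory Defs
  imports "HOL-Analysis.Analysis"
begin

text \<open>
  Functions on a domain of \<open>\<complex>\<^sup>n\<close> are represented by total functions on \<^typ>\<open>complex^'n\<close>; the
  function spaces below only constrain their values on the domain.
\<close>

text \<open>Holomorphy in several variables: real (Frechet) differentiability with complex-linear
  derivative. Intended for open sets only.\<close>

definition holomorphic_several :: "(complex^'n \<Rightarrow> complex) \<Rightarrow> (complex^'n) set \<Rightarrow> bool" where
  "holomorphic_several f \<Omega> \<longleftrightarrow>
     (\<forall>z\<in>\<Omega>. \<exists>D. (f has_derivative D) (at z) \<and> (\<forall>c v. D (c *s v) = c * D v))"

definition L2_space :: "(complex^'n) set \<Rightarrow> (complex^'n \<Rightarrow> complex) set" where
  "L2_space \<Omega> = {f. f \<in> borel_measurable (lebesgue_on \<Omega>) \<and>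
                     integrable (lebesgue_on \<Omega>) (\<lambda>z. (cmod (f z))\<^sup>2)}"

definition L2_inner ::
    "(complex^'n) set \<Rightarrow> (complex^'n \<Rightarrow> complex) \<Rightarrow> (complex^'n \<Rightarrow> complex) \<Rightarrow> complex" where
  "L2_inner \<Omega> f g = (\<integral>z. f z * cnj (g z) \<partial>lebesgue_on \<Omega>)"

definition bergman_space :: "(complex^'n) set \<Rightarrow> (complex^'n \<Rightarrow> complex) set" where
  "bergman_space \<Omega> = {f \<in> L2_space \<Omega>. holomorphic_several f \<Omega>}"

text \<open>Essential boundedness is rendered as boundedness; the two agree for continuous functions
  on an open set.\<close>

definition H_infinity :: "(complex^'n) set \<Rightarrow> (complex^'n \<Rightarrow> complex) set" where
  "H_infinity \<Omega> = {f. holomorphic_several f \<Omega> \<and> bounded (f ` \<Omega>)}"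

definition sup_norm :: "(complex^'n) set \<Rightarrow> (complex^'n \<Rightarrow> complex) \<Rightarrow> real" where
  "sup_norm \<Omega> f = (SUP z\<in>\<Omega>. cmod (f z))"

text \<open>The orthogonal projection of \<open>g \<in> L\<^sup>2(\<Omega>)\<close> onto \<open>A\<^sup>2(\<Omega>)\<close>: the element \<open>h\<close> of \<open>A\<^sup>2(\<Omega>)\<close>
  with \<open>g - h\<close> orthogonal to \<open>A\<^sup>2(\<Omega>)\<close>. For open \<open>\<Omega>\<close> its values on \<open>\<Omega>\<close> are unique; the value 0
  prescribed off \<open>\<Omega>\<close> makes it unique as a total function.\<close>

definition bergman_projection ::
    "(complex^'n) set \<Rightarrow> (complex^'n \<Rightarrow> complex) \<Rightarrow> complex^'n \<Rightarrow> complex" where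
  "bergman_projection \<Omega> g =
     (THE h. h \<in> bergman_space \<Omega> \<and> (\<forall>z. z \<notin> \<Omega> \<longrightarrow> h z = 0) \<and>
             (\<forall>k\<in>bergman_space \<Omega>. L2_inner \<Omega> (\<lambda>z. g z - h z) k = 0))"

definition friedrichs_operator ::
    "(complex^'n) set \<Rightarrow> (complex^'n \<Rightarrow> complex) \<Rightarrow> complex^'n \<Rightarrow> complex" where
  "friedrichs_operator \<Omega> g = bergman_projection \<Omega> (\<lambda>z. cnj (g z))"

definition bounded_operator ::
    "'a set \<Rightarrow> ('a \<Rightarrow> real) \<Rightarrow> 'b set \<Rightarrow> ('b \<Rightarrow> real) \<Rightarrow> ('a \<Rightarrow> 'b) \<Rightarrow> bool" where
  "bounded_operator X normX Y normY T \<longleftrightarrow>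
     (\<forall>x\<in>X. T x \<in> Y) \<and> (\<exists>C. \<forall>x\<in>X. normY (T x) \<le> C * normX x)"

definition exponential_hartogs_triangle :: "(complex^2) set" where
  "exponential_hartogs_triangle =
     {z. cmod (z $ 1) < exp (- 1 / cmod (z $ 2)) \<and> z $ 2 \<in> ball 0 1 - {0}}"

end

theory Submission
  imports Defs "HOL-Complex_Analysis.Residue_Theorem"
begin

text \<open>
  Write \<open>\<Omega>\<close> for the exponential Hartogs triangle, \<open>w\<close> for the second coordinate and
  \<open>c\<^sub>n = \<integral>\<^sub>\<Omega> \<bar>w\<bar>\<^sup>2\<^sup>n\<close> for integer \<open>n\<close>; every \<open>c\<^sub>n\<close> is finite because \<open>\<Omega>\<close> is exponentially thin near
  \<open>w = 0\<close>. The domain and Lebesgue measure are invariant under rotating each coordinate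
  separately, so an integral over \<open>\<Omega>\<close> does not change when the integrand is averaged over these
  rotations. For holomorphic \<open>k\<close>, averaging in the first coordinate replaces \<open>k(z\<^sub>1,w)\<close> by
  \<open>k(0,w)\<close>, and averaging in the second extracts a Laurent coefficient of \<open>k(0,w)\<close>. In particular
  \<open>\<integral> cnj (w\<^sup>n) k\<close> and \<open>\<integral> k / w\<^sup>n\<close> are the same coefficient of \<open>k\<close> times \<open>c\<^sub>n\<close> and \<open>c\<^sub>0\<close>
  respectively (\<open>integral_cnj_monomial_mult\<close>).

  Hence the Friedrichs operator only sees \<open>g(0,w)\<close> and sends \<open>w\<^sup>n\<close> to \<open>c\<^sub>0 / c\<^sub>-\<^sub>n\<close> times
  \<open>w\<^sup>-\<^sup>n\<close>, conjugate-linearly. If \<open>g\<close> is bounded by \<open>B\<close>, then \<open>g(0,w)\<close> has a removable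
  singularity at \<open>0\<close>; it is \<open>\<Sum>\<^sub>b \<gamma>\<^sub>b w\<^sup>b\<close> over \<open>b \<ge> 0\<close>, with \<open>\<bar>\<gamma>\<^sub>b\<bar> \<le> 2\<^sup>b B\<close> by Cauchy's
  inequality on the circle of radius one half. Therefore
  \<open>F\<^sup>2 g = \<Sum>\<^sub>b \<gamma>\<^sub>b (c\<^sub>0\<^sup>2 / (c\<^sub>b c\<^sub>-\<^sub>b)) w\<^sup>b\<close> (\<open>friedrichs_square_eq\<close>).

  The denominators win. Since \<open>\<Omega>\<close> has points with \<open>\<bar>w\<bar>\<close> as small or as close to \<open>1\<close> as one
  likes, for each \<open>\<rho>\<close> in \<open>(0,1)\<close> there is \<open>v > 0\<close> with \<open>c\<^sub>n \<ge> v \<rho>\<^sup>2\<^sup>n\<close> for all \<open>n\<close>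
  (\<open>moment_lower_bound\<close>). Taking \<open>\<rho>\<close> small for \<open>c\<^sub>-\<^sub>b\<close> and moderate for \<open>c\<^sub>b\<close> makes
  \<open>2\<^sup>b c\<^sub>0\<^sup>2 / (c\<^sub>b c\<^sub>-\<^sub>b)\<close> summable, and its sum is a bound for the operator on \<open>H\<^sup>\<infinity>\<close>.

  The formula for \<open>F\<close> is not read off from an orthonormal basis. Instead the candidate series is
  shown to lie in the Bergman space, and its difference from the projected function is tested
  against every element of that space (\<open>bergman_projection_eq_monomial_series\<close>); uniqueness of
  the projection does the rest (\<open>bergman_projection_eqI\<close>).
\<close>

section \<open>Orthogonal maps preserve Lebesgue measure\<close>

lemma lborel_distr_orthogonal_cart:
  fixes f :: "real^'n::{finite,wellorder} \<Rightarrow> real^'n::_"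
  assumes f: "orthogonal_transformation f"
  shows "distr lborel borel f = lborel"
proof (rule lborel_eqI[symmetric])
  show "sets (distr lborel borel f) = sets borel" by simp
  fix l u :: "real^'n::_" assume lu: "\<And>b. b \<in> Basis \<Longrightarrow> l \<bullet> b \<le> u \<bullet> b"
  have lin: "linear f" and bijf: "bij f"
    using f by (simp_all add: orthogonal_transformation_linear orthogonal_transformation_bij)
  have cont: "continuous_on UNIV f" using lin by (simp add: linear_continuous_on linear_linear)
  have meas[measurable]: "f \<in> borel_measurable borel"
    by (rule borel_measurable_continuous_onI[OF cont])
  have inv: "orthogonal_transformation (inv f)" using f by (rule orthogonal_transformation_inv)
  have pre: "f -` box l u = inv f ` box l u" using bijf by (rule bij_vimage_eq_inv_image)
  have m: "f -` box l u \<in> sets borel"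
    using measurable_sets_borel[OF meas, of "box l u"] by simp
  have lm: "f -` box l u \<in> lmeasurable"
    unfolding pre by (rule measurable_orthogonal_image[OF inv]) simp
  have "emeasure (distr lborel borel f) (box l u) = emeasure lborel (f -` box l u)"
    by (simp add: emeasure_distr)
  also have "\<dots> = emeasure lebesgue (f -` box l u)" using m by simp
  also have "\<dots> = ennreal (measure lebesgue (f -` box l u))"
    using lm by (metis emeasure_eq_measure2)
  also have "measure lebesgue (f -` box l u) = measure lebesgue (box l u)"
    unfolding pre by (rule measure_orthogonal_image[OF inv]) simp
  also have "\<dots> = (\<Prod>b\<in>Basis. (u - l) \<bullet> b)"
    using lu by simp
  finally show "emeasure (distr lborel borel f) (box l u) = (\<Prod>b\<in>Basis. (u - l) \<bullet> b)" .
qed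

lemma inner_coordinate_sum:
  fixes \<sigma> :: "'n::finite \<Rightarrow> 'a::euclidean_space" and x :: "real^'n"
  assumes bij: "bij_betw \<sigma> UNIV Basis"
  shows "(\<Sum>j\<in>UNIV. x $ j *\<^sub>R \<sigma> j) \<bullet> \<sigma> i = x $ i"
proof -
  have inj: "inj \<sigma>" and ran: "range \<sigma> = Basis" using bij by (auto simp: bij_betw_def)
  have "(\<Sum>j\<in>UNIV. x $ j *\<^sub>R \<sigma> j) \<bullet> \<sigma> i = (\<Sum>j\<in>UNIV. x $ j * (\<sigma> j \<bullet> \<sigma> i))"
    by (simp add: inner_sum_left)
  also have "\<dots> = (\<Sum>j\<in>UNIV. if j = i then x $ j else 0)"
  proof (intro sum.cong refl)
    fix j
    have "\<sigma> j \<in> Basis" "\<sigma> i \<in> Basis" using ran by auto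
    then show "x $ j * (\<sigma> j \<bullet> \<sigma> i) = (if j = i then x $ j else 0)"
      using inj by (auto simp: inner_Basis inj_eq)
  qed
  finally show ?thesis by simp
qed

text \<open>
  Coordinates with respect to the standard basis identify a Euclidean space with a space of real
  vectors; this carries the invariance of Lebesgue measure from \<open>real^'n\<close> to spaces such as
  \<open>complex^2\<close>. A box corresponds to the box with the same side lengths.
\<close>
lemma lborel_distr_coordinates:
  fixes \<sigma> :: "'n::finite \<Rightarrow> 'a::euclidean_space"
  assumes bij: "bij_betw \<sigma> UNIV Basis"
  shows "distr lborel borel (\<lambda>x::real^'n. \<Sum>i\<in>UNIV. x $ i *\<^sub>R \<sigma> i) = lborel"
proof (rule lborel_eqI[symmetric])
  let ?T = "\<lambda>x::real^'n. \<Sum>i\<in>UNIV. x $ i *\<^sub>R \<sigma> i"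
  have inj: "inj \<sigma>" and ran: "range \<sigma> = Basis" using bij by (auto simp: bij_betw_def)
  have coord: "?T x \<bullet> \<sigma> i = x $ i" for x i
    by (rule inner_coordinate_sum[OF bij])
  show "sets (distr lborel borel ?T) = sets borel" by simp
  fix l u :: 'a assume lu: "\<And>b. b \<in> Basis \<Longrightarrow> l \<bullet> b \<le> u \<bullet> b"
  have meas[measurable]: "?T \<in> borel_measurable borel"
    by (intro borel_measurable_continuous_onI continuous_intros)
  let ?l = "\<chi> i. l \<bullet> \<sigma> i" and ?u = "\<chi> i. u \<bullet> \<sigma> i"
  have pre: "?T -` box l u = box ?l ?u"
    unfolding box_def ran[symmetric] by (auto simp: coord Basis_vec_def inner_axis)
  have "emeasure (distr lborel borel ?T) (box l u) = emeasure lborel (?T -` box l u)"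
    by (simp add: emeasure_distr)
  also have "\<dots> = (\<Prod>b\<in>Basis. (?u - ?l) \<bullet> b)"
  proof -
    have "\<sigma> i \<in> Basis" for i using ran by auto
    then show ?thesis
      unfolding pre using lu by (subst emeasure_lborel_box) (auto simp: Basis_vec_def inner_axis)
  qed
  also have "(\<Prod>b\<in>Basis. (?u - ?l) \<bullet> b) = (\<Prod>i\<in>UNIV. (?u - ?l) $ i)"
  proof -
    have B: "(Basis :: (real^'n) set) = (\<lambda>i. axis i 1) ` UNIV" by (auto simp: Basis_vec_def)
    have "inj (\<lambda>i::'n. axis i (1::real))" by (auto simp: inj_def axis_eq_axis)
    then show ?thesis unfolding B by (subst prod.reindex) (auto simp: inner_axis)
  qed
  also have "\<dots> = (\<Prod>b\<in>Basis. (u - l) \<bullet> b)"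
    using inj by (simp add: ran[symmetric] prod.reindex inner_diff_left)
  finally show "emeasure (distr lborel borel ?T) (box l u) = (\<Prod>b\<in>Basis. (u - l) \<bullet> b)" .
qed

text \<open>
  The map is conjugated with the coordinates to an orthogonal map of \<open>real^'n\<close>. The
  enumeration \<open>\<sigma>\<close> of the basis supplies an index type of the right size.
\<close>
lemma lborel_distr_orthogonal_transformation:
  fixes U :: "'a::euclidean_space \<Rightarrow> 'a" and \<sigma> :: "'n::{finite,wellorder} \<Rightarrow> 'a"
  assumes U: "orthogonal_transformation U" and bij: "bij_betw \<sigma> UNIV Basis"
  shows "distr lborel borel U = lborel"
proof -
  define T where "T = (\<lambda>x::real^'n::_. \<Sum>i\<in>UNIV. x $ i *\<^sub>R \<sigma> i)"
  define S where "S = (\<lambda>y::'a. (\<chi> i. y \<bullet> \<sigma> i) :: real^'n::_)"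
  have inj: "inj \<sigma>" and ran: "range \<sigma> = Basis" using bij by (auto simp: bij_betw_def)
  have coord: "T x \<bullet> \<sigma> i = x $ i" for x i
    unfolding T_def by (rule inner_coordinate_sum[OF bij])
  have TS: "T (S y) = y" for y
  proof (rule euclidean_eqI)
    fix b :: 'a assume "b \<in> Basis"
    then obtain i where "b = \<sigma> i" using ran by auto
    then show "T (S y) \<bullet> b = y \<bullet> b" by (simp add: coord) (simp add: S_def)
  qed
  have linT: "linear T" unfolding T_def
    by (intro linear_compose_sum ballI linearI) (simp_all add: scaleR_add_left)
  have linS: "linear S" unfolding S_def
    by (rule linearI) (simp_all add: vec_eq_iff inner_add_left)
  have innerT: "T x \<bullet> T y = x \<bullet> y" for x y
  proof -
    have "T x \<bullet> T y = (\<Sum>i\<in>UNIV. y $ i * (T x \<bullet> \<sigma> i))"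
      by (subst (2) T_def) (simp add: inner_sum_right)
    then show ?thesis by (simp add: coord inner_vec_def mult.commute)
  qed
  have innerS: "S x \<bullet> S y = x \<bullet> y" for x y using innerT[of "S x" "S y"] by (simp add: TS)
  have linU: "linear U" using U by (rule orthogonal_transformation_linear)
  have orth: "orthogonal_transformation (S \<circ> U \<circ> T)"
    unfolding orthogonal_transformation_def
    using U by (auto intro!: linear_compose linT linS linU simp: innerS innerT orthogonal_transformation_def)
  have [measurable]: "T \<in> borel_measurable borel" "S \<in> borel_measurable borel"
      "U \<in> borel_measurable borel"
    by (auto intro!: borel_measurable_continuous_onI linear_continuous_on linT linS linU
          simp: linear_conv_bounded_linear[symmetric])
  have dT: "distr lborel borel T = lborel"
    unfolding T_def by (rule lborel_distr_coordinates[OF bij])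
  have "distr lborel borel U = distr (distr lborel borel T) borel U" by (simp add: dT)
  also have "\<dots> = distr lborel borel (U \<circ> T)" by (subst distr_distr) auto
  also have "U \<circ> T = T \<circ> (S \<circ> U \<circ> T)" by (auto simp: TS)
  also have "distr lborel borel \<dots> = distr (distr lborel borel (S \<circ> U \<circ> T)) borel T"
    by (subst distr_distr) auto
  also have "\<dots> = lborel" by (simp only: lborel_distr_orthogonal_cart[OF orth] dT)
  finally show ?thesis .
qed

lemma lborel_distr_unitary_diagonal:
  assumes a: "cmod a = 1" and b: "cmod b = 1"
  shows "distr lborel borel (\<lambda>z::complex^2. \<chi> i. (if i = 1 then a else b) * z $ i) = lborel"
proof -
  let ?U = "\<lambda>z::complex^2. \<chi> i. (if i = 1 then a else b) * z $ i"
  have "linear ?U" by (rule linearI) (simp_all add: vec_eq_iff algebra_simps)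
  moreover have "norm (?U z) = norm z" for z
    using a b by (auto simp: norm_vec_def L2_set_def norm_mult intro!: sum.cong)
  ultimately have U: "orthogonal_transformation ?U" by (simp add: orthogonal_transformation)
  \<comment> \<open>The type \<open>4\<close> indexes the four real coordinates of \<open>complex^2\<close>.\<close>
  have "card (UNIV :: 4 set) = card (Basis :: (complex^2) set)" by simp
  then obtain \<sigma> :: "4 \<Rightarrow> complex^2" where "bij_betw \<sigma> UNIV Basis"
    by (metis finite_same_card_bij finite_Basis finite)
  then show ?thesis by (rule lborel_distr_orthogonal_transformation[OF U])
qed

section \<open>Averages over rotations\<close>

text \<open>
  Fubini: for each \<open>t\<close> the integral of \<open>F \<circ> R t\<close> is that of \<open>F\<close>, so the same holds for the mean
  over \<open>t\<close>.
\<close>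
lemma integral_average_over_flow:
  fixes F :: "'a::euclidean_space \<Rightarrow> complex" and R :: "real \<Rightarrow> 'a \<Rightarrow> 'a"
  assumes F: "integrable lborel F"
    and R[measurable]: "(\<lambda>(t, z). R t z) \<in> borel_measurable (borel \<Otimes>\<^sub>M borel)"
    and inv: "\<And>t. distr lborel borel (R t) = lborel"
  shows "integrable lborel (\<lambda>z. \<integral>t. F (R t z) \<partial>lebesgue_on {0..1})" (is ?int)
    and "(\<integral>z. (\<integral>t. F (R t z) \<partial>lebesgue_on {0..1}) \<partial>lborel) = (\<integral>z. F z \<partial>lborel)" (is ?eq)
proof -
  define N :: "real measure" where "N = restrict_space lborel {0..1}"
  interpret N: finite_measure N
    by (rule finite_measureI) (simp add: N_def emeasure_restrict_space)
  have N1: "measure N (space N) = 1" by (simp add: N_def measure_restrict_space)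
  interpret P: pair_sigma_finite N "lborel :: 'a measure" ..
  have [measurable]: "F \<in> borel_measurable borel" using F by auto
  have [measurable]: "(\<lambda>t. t) \<in> measurable N borel"
    by (simp add: N_def measurable_restrict_space1)
  have [measurable]: "R t \<in> borel_measurable borel" for t
    using measurable_Pair2[OF R, of t] by simp
  have mp: "(\<lambda>(t, z). F (R t z)) \<in> borel_measurable (N \<Otimes>\<^sub>M lborel)" by measurable
  have slice: "integrable lborel (\<lambda>z. F (R t z))" for t
    using F inv[of t] integrable_distr_eq[of "R t" lborel borel F] by simp
  have slice_eq: "(\<integral>z. g (R t z) \<partial>lborel) = (\<integral>z. g z \<partial>lborel)"
    if [measurable]: "g \<in> borel_measurable borel" for t and g :: "'a \<Rightarrow> 'b::{banach,second_countable_topology}"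
    using inv[of t] integral_distr[of "R t" lborel borel g] by simp
  have prod: "integrable (N \<Otimes>\<^sub>M lborel) (\<lambda>(t, z). F (R t z))"
  proof (rule P.Fubini_integrable[OF mp])
    show "integrable N (\<lambda>t. \<integral>z. norm (case (t, z) of (t, z) \<Rightarrow> F (R t z)) \<partial>lborel)"
      using slice_eq[of "\<lambda>z. norm (F z)"] by simp
    show "AE t in N. integrable lborel (\<lambda>z. case (t, z) of (t, z) \<Rightarrow> F (R t z))"
      using slice by simp
  qed
  have toN: "(\<integral>t. F (R t z) \<partial>lebesgue_on {0..1}) = (\<integral>t. F (R t z) \<partial>N)" for z
  proof -
    have "(\<lambda>t. R t z) \<in> borel_measurable borel"
      using measurable_Pair1[OF R, of z] by simp
    then have "(\<lambda>t. F (R t z)) \<in> borel_measurable borel"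
      by (rule measurable_compose) measurable
    then have "(\<lambda>t. indicator {0..1} t *\<^sub>R F (R t z)) \<in> borel_measurable lborel"
      by simp
    then show ?thesis
      unfolding N_def by (simp add: integral_restrict_space integral_completion)
  qed
  show ?int unfolding toN using P.integrable_snd[OF prod] by simp
  have "(\<integral>z. (\<integral>t. F (R t z) \<partial>N) \<partial>lborel) = (\<integral>t. (\<integral>z. F (R t z) \<partial>lborel) \<partial>N)"
    using P.Fubini_integral[OF prod] by simp
  also have "\<dots> = (\<integral>z. F z \<partial>lborel)"
    using N1 by (simp add: slice_eq)
  finally show ?eq unfolding toN .
qed

lemma integral_unit_interval_periodic_shift:
  fixes F :: "real \<Rightarrow> complex"
  assumes cont: "continuous_on UNIV F" and per: "\<And>t. F (t + 1) = F t" and a: "0 \<le> a" "a \<le> 1"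
  shows "integral {0..1} (\<lambda>t. F (t + a)) = integral {0..1} F"
proof -
  have io: "F integrable_on {u..v}" for u v
    by (rule integrable_continuous_interval) (rule continuous_on_subset[OF cont], simp)
  have sh: "integral {u..v} (\<lambda>t. F (t + c)) = integral {u + c..v + c} F" for u v c
  proof -
    have "((\<lambda>t. F (t + c)) has_integral integral {u + c..v + c} F) {u..v}"
      using has_integral_affinity[of F "integral {u + c..v + c} F" "u + c" "v + c" 1 c] io[of "u+c" "v+c"]
      by (simp add: image_affinity_atLeastAtMost_diff box_real has_integral_integral)
    then show ?thesis by (rule integral_unique)
  qed
  have "integral {0..1} (\<lambda>t. F (t + a)) = integral {a..1 + a} F" by (simp add: sh)
  also have "\<dots> = integral {a..1} F + integral {1..1 + a} F"
    using a by (intro Henstock_Kurzweil_Integration.integral_combine[symmetric] io) auto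
  also have "integral {1..1 + a} F = integral {0..a} (\<lambda>t. F (t + 1))" using sh[of 0 a 1] by (simp add: add.commute)
  also have "\<dots> = integral {0..a} F" by (simp add: per)
  also have "integral {a..1} F + integral {0..a} F = integral {0..1} F"
    using a by (subst add.commute, intro Henstock_Kurzweil_Integration.integral_combine io) auto
  finally show ?thesis .
qed

definition rot :: "real \<Rightarrow> complex" where "rot t = cis (2 * pi * t)"

lemma norm_rot [simp]: "cmod (rot t) = 1" by (simp add: rot_def)
lemma rot_plus: "rot (s + t) = rot s * rot t" by (simp add: rot_def cis_mult algebra_simps)
lemma rot_1 [simp]: "rot 1 = 1" by (simp add: rot_def)
lemma continuous_on_rot [continuous_intros]: "continuous_on S f \<Longrightarrow> continuous_on S (\<lambda>x. rot (f x))"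
  unfolding rot_def cis_conv_exp by (intro continuous_intros)

definition circle_mean :: "(complex \<Rightarrow> complex) \<Rightarrow> complex \<Rightarrow> complex" where
  "circle_mean p w = (\<integral>t. p (rot t * w) \<partial>lebesgue_on {0..1})"

lemma circle_mean_conv_integral:
  assumes "continuous_on (sphere 0 (cmod w)) p"
  shows "circle_mean p w = integral {0..1} (\<lambda>t. p (rot t * w))"
    "integrable (lebesgue_on {0..1}) (\<lambda>t. p (rot t * w))"
proof -
  have "continuous_on {0..1} (\<lambda>t. p (rot t * w))"
    by (rule continuous_on_compose2[OF assms]) (auto intro!: continuous_intros simp: norm_mult)
  then show i: "integrable (lebesgue_on {0..1}) (\<lambda>t. p (rot t * w))"
    by (rule continuous_imp_integrable_real)
  show "circle_mean p w = integral {0..1} (\<lambda>t. p (rot t * w))"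
    unfolding circle_mean_def by (rule lebesgue_integral_eq_integral[OF i]) simp
qed

text \<open>
  The contour integral over a circle path starts on the positive real axis, whereas
  \<open>circle_mean p w\<close> starts at \<open>w\<close>. Rotating the starting point shifts a periodic integrand.
\<close>
lemma circle_mean_phase:
  assumes cont: "continuous_on (sphere 0 (cmod w)) p"
  shows "circle_mean p w = circle_mean p (of_real (cmod w))"
proof -
  obtain a where a: "0 \<le> a" "a \<le> 1" "w = rot a * of_real (cmod w)"
  proof -
    have "w = of_real (cmod w) * cis (Arg2pi w)"
      using Arg2pi_eq[of w] by (simp add: cis_conv_exp mult.commute)
    moreover have "0 \<le> Arg2pi w / (2*pi)" "Arg2pi w / (2*pi) \<le> 1"
      using Arg2pi_ge_0[of w] Arg2pi_lt_2pi[of w] by (auto simp: field_simps)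
    ultimately show ?thesis using that[of "Arg2pi w / (2*pi)"] by (simp add: rot_def mult.commute)
  qed
  let ?F = "\<lambda>t. p (rot t * of_real (cmod w))"
  have c: "continuous_on UNIV ?F"
    by (rule continuous_on_compose2[OF cont]) (auto intro!: continuous_intros simp: norm_mult)
  have "circle_mean p w = integral {0..1} (\<lambda>t. p (rot t * w))"
    by (rule circle_mean_conv_integral[OF cont])
  also have "\<dots> = integral {0..1} (\<lambda>t. ?F (t + a))"
    by (subst a(3)) (simp add: rot_plus mult.assoc)
  also have "\<dots> = integral {0..1} ?F"
    by (rule integral_unit_interval_periodic_shift[OF c _ a(1,2)]) (simp add: rot_plus)
  also have "\<dots> = circle_mean p (of_real (cmod w))"
    by (subst circle_mean_conv_integral) (use cont in auto)
  finally show ?thesis .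
qed

text \<open>
  Along the circle \<open>dw / w = 2 \<pi> \<i> dt\<close>.
\<close>
lemma circle_mean_contour:
  assumes r: "r > 0" and cont: "continuous_on (sphere 0 r) p"
    and I: "((\<lambda>w. p w / w) has_contour_integral (2 * pi * \<i> * I)) (circlepath 0 r)"
  shows "circle_mean p (of_real r) = I"
proof -
  have "((\<lambda>t. (p (circlepath 0 r t) / circlepath 0 r t) *
      vector_derivative (circlepath 0 r) (at t within {0..1})) has_integral 2 * pi * \<i> * I) {0..1}"
    using I unfolding has_contour_integral_def .
  then have "((\<lambda>t. 2 * pi * \<i> * p (rot t * of_real r)) has_integral 2 * pi * \<i> * I) {0..1}"
  proof (rule has_integral_eq[rotated])
    fix t :: real assume t: "t \<in> {0..1}"
    have c: "circlepath 0 r t = rot t * of_real r"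
      by (simp add: circlepath rot_def cis_conv_exp mult_ac)
    have "vector_derivative (circlepath 0 r) (at t within {0..1}) = 2 * pi * \<i> * (rot t * of_real r)"
      using t by (simp add: vector_derivative_circlepath01 rot_def cis_conv_exp mult_ac)
    then show "(p (circlepath 0 r t) / circlepath 0 r t) *
        vector_derivative (circlepath 0 r) (at t within {0..1}) = 2 * pi * \<i> * p (rot t * of_real r)"
      unfolding c using r by (simp add: rot_def)
  qed
  then have "((\<lambda>t. p (rot t * of_real r)) has_integral I) {0..1}"
    by (drule_tac has_integral_mult_right[where c = "1 / (2 * pi * \<i>)"]) simp
  then show ?thesis
    using circle_mean_conv_integral(1)[of "of_real r" p] r cont by (simp add: integral_unique)
qed

lemma circle_mean_disc:
  assumes hol: "p holomorphic_on ball 0 R" and w: "cmod w < R"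
  shows "circle_mean p w = p 0"
proof (cases "w = 0")
  case True
  then show ?thesis by (simp add: circle_mean_def measure_restrict_space)
next
  case False
  define r where "r = cmod w"
  have r: "0 < r" "r < R" using False w by (auto simp: r_def)
  have sub: "cball 0 r \<subseteq> ball 0 R" using r by auto
  have cont: "continuous_on (sphere 0 r) p"
    by (rule continuous_on_subset[OF holomorphic_on_imp_continuous_on[OF hol]]) (use r in auto)
  have "((\<lambda>u. p u / (u - 0)) has_contour_integral 2 * of_real pi * \<i> * p 0) (circlepath 0 r)"
    by (rule Cauchy_integral_circlepath_simple) (use r sub hol in \<open>auto intro: holomorphic_on_subset\<close>)
  then have "circle_mean p (of_real r) = p 0"
    by (intro circle_mean_contour r cont) simp
  then show ?thesis using circle_mean_phase[of w p] cont by (simp add: r_def)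
qed

text \<open>
  The residue is the Laurent coefficient of \<open>p\<close> of degree \<open>0\<close>; the point of the lemma is that
  the mean does not depend on \<open>w\<close>.
\<close>
lemma circle_mean_punctured_disc:
  assumes hol: "p holomorphic_on ball 0 1 - {0}" and w: "0 < cmod w" "cmod w < 1"
  shows "circle_mean p w = residue (\<lambda>u. p u / u) 0"
proof -
  define r where "r = cmod w"
  have r: "0 < r" "r < 1" using w by (auto simp: r_def)
  have cont: "continuous_on (sphere 0 r) p"
    by (rule continuous_on_subset[OF holomorphic_on_imp_continuous_on[OF hol]]) (use r in auto)
  have "((\<lambda>u. p u / u) has_contour_integral 2 * pi * \<i> * residue (\<lambda>u. p u / u) 0) (circlepath 0 r)"
    by (rule base_residue[of "ball 0 1"]) (use r hol in \<open>auto intro!: holomorphic_intros\<close>)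
  then have "circle_mean p (of_real r) = residue (\<lambda>u. p u / u) 0"
    by (intro circle_mean_contour r cont) simp
  then show ?thesis using circle_mean_phase[of w p] cont by (simp add: r_def)
qed

section \<open>Holomorphic functions of several variables\<close>

lemma holomorphic_several_imp_continuous_on:
  assumes "holomorphic_several f S"
  shows "continuous_on S f"
  unfolding continuous_on_eq_continuous_within
proof
  fix z assume "z \<in> S"
  then obtain D where "(f has_derivative D) (at z)" using assms by (auto simp: holomorphic_several_def)
  then show "continuous (at z within S) f"
    by (meson has_derivative_continuous continuous_at_imp_continuous_at_within)
qed

lemma holomorphic_several_mult:
  assumes "holomorphic_several f S" "holomorphic_several g S"
  shows "holomorphic_several (\<lambda>z. f z * g z) S"
  unfolding holomorphic_several_def
proof
  fix z assume "z \<in> S"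
  then obtain D E where D: "(f has_derivative D) (at z)" "\<And>c v. D (c *s v) = c * D v"
    and E: "(g has_derivative E) (at z)" "\<And>c v. E (c *s v) = c * E v"
    using assms unfolding holomorphic_several_def by meson
  show "\<exists>D. ((\<lambda>z. f z * g z) has_derivative D) (at z) \<and> (\<forall>c v. D (c *s v) = c * D v)"
    by (rule exI, rule conjI, rule has_derivative_mult[OF D(1) E(1)]) (simp add: D(2) E(2) algebra_simps)
qed

lemma holomorphic_several_diff:
  assumes "holomorphic_several f S" "holomorphic_several g S"
  shows "holomorphic_several (\<lambda>z. f z - g z) S"
  unfolding holomorphic_several_def
proof
  fix z assume "z \<in> S"
  then obtain D E where D: "(f has_derivative D) (at z)" "\<And>c v. D (c *s v) = c * D v"
    and E: "(g has_derivative E) (at z)" "\<And>c v. E (c *s v) = c * E v"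
    using assms unfolding holomorphic_several_def by meson
  show "\<exists>D. ((\<lambda>z. f z - g z) has_derivative D) (at z) \<and> (\<forall>c v. D (c *s v) = c * D v)"
    by (rule exI, rule conjI, rule has_derivative_diff[OF D(1) E(1)]) (simp add: D(2) E(2) algebra_simps)
qed

lemma holomorphic_several_cong_open:
  assumes "holomorphic_several f S" "open S" "\<And>z. z \<in> S \<Longrightarrow> f z = g z"
  shows "holomorphic_several g S"
  unfolding holomorphic_several_def
proof
  fix z assume z: "z \<in> S"
  then obtain D where D: "(f has_derivative D) (at z)" "\<And>c v. D (c *s v) = c * D v"
    using assms unfolding holomorphic_several_def by meson
  have "(g has_derivative D) (at z)"
    by (rule has_derivative_transform_within_open[OF D(1) assms(2) z]) (use assms in auto)
  with D(2) show "\<exists>D. (g has_derivative D) (at z) \<and> (\<forall>c v. D (c *s v) = c * D v)" by blast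
qed

lemma holomorphic_several_component:
  fixes S :: "(complex^'n) set"
  assumes hol: "\<phi> holomorphic_on T" and "open T" and sub: "\<And>z. z \<in> S \<Longrightarrow> z $ i \<in> T"
  shows "holomorphic_several (\<lambda>z. \<phi> (z $ i)) S"
  unfolding holomorphic_several_def
proof
  fix z :: "complex^'n" assume z: "z \<in> S"
  have "(\<phi> has_field_derivative deriv \<phi> (z $ i)) (at (z $ i))"
    using hol \<open>open T\<close> sub[OF z] by (rule holomorphic_derivI)
  then have "(\<phi> has_derivative (*) (deriv \<phi> (z $ i))) (at (z $ i))"
    by (simp add: has_field_derivative_def)
  moreover have "((\<lambda>z. z $ i) has_derivative (\<lambda>z. z $ i)) (at z)"
    by (rule bounded_linear.has_derivative[OF bounded_linear_vec_nth]) (rule has_derivative_ident)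
  ultimately have "((\<lambda>z. \<phi> (z $ i)) has_derivative (\<lambda>v. deriv \<phi> (z $ i) * v $ i)) (at z)"
    by (rule has_derivative_compose[rotated])
  then show "\<exists>D. ((\<lambda>z. \<phi> (z $ i)) has_derivative D) (at z) \<and> (\<forall>c v. D (c *s v) = c * D v)"
    by (intro exI conjI) (auto simp: mult_ac)
qed

lemma holomorphic_several_on_line:
  assumes hol: "holomorphic_several f S" and sub: "\<And>u. u \<in> T \<Longrightarrow> a + u *s v \<in> S" and "open T"
  shows "(\<lambda>u. f (a + u *s v)) holomorphic_on T"
  unfolding holomorphic_on_open[OF \<open>open T\<close>]
proof
  fix u assume "u \<in> T"
  then obtain D where D: "(f has_derivative D) (at (a + u *s v))" "\<And>c v. D (c *s v) = c * D v"
    using hol sub unfolding holomorphic_several_def by meson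
  have "linear (\<lambda>u::complex. u *s v)"
    by (rule linearI) (simp_all add: vec_eq_iff algebra_simps)
  then have "((\<lambda>u. a + u *s v) has_derivative (\<lambda>h. h *s v)) (at u)"
    using has_derivative_add[OF has_derivative_const linear_imp_has_derivative] by simp
  from has_derivative_compose[OF this D(1)]
  have "((\<lambda>u. f (a + u *s v)) has_field_derivative D v) (at u)"
    unfolding has_field_derivative_def by (simp add: D(2) mult.commute[of _ "D v"] lambda_one)
  then show "\<exists>f'. ((\<lambda>u. f (a + u *s v)) has_field_derivative f') (at u)" by blast
qed

section \<open>The exponential Hartogs triangle\<close>

abbreviation \<Omega> :: "(complex^2) set" where "\<Omega> \<equiv> exponential_hartogs_triangle"

definition pt :: "complex \<Rightarrow> complex \<Rightarrow> complex^2" where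
  "pt a b = (\<chi> i. if i = 1 then a else b)"

lemma pt_nth [simp]: "pt a b $ 1 = a" "pt a b $ 2 = b" by (simp_all add: pt_def)

lemma mem_hartogs:
  "z \<in> \<Omega> \<longleftrightarrow> cmod (z $ 1) < exp (- 1 / cmod (z $ 2)) \<and> 0 < cmod (z $ 2) \<and> cmod (z $ 2) < 1"
  by (auto simp: exponential_hartogs_triangle_def)

lemma open_hartogs: "open \<Omega>"
proof -
  let ?U = "{z :: complex^2. z $ 2 \<noteq> 0}"
  have U: "open ?U" by (intro open_Collect_neq continuous_intros)
  let ?g = "\<lambda>z::complex^2. exp (- 1 / cmod (z $ 2)) - cmod (z $ 1)"
  have "continuous_on ?U ?g" by (intro continuous_intros) auto
  then have "open (?g -` {0<..} \<inter> ?U)" using U by (simp add: continuous_on_open_vimage)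
  moreover have "open {z :: complex^2. cmod (z $ 2) < 1}" by (intro open_Collect_less continuous_intros)
  ultimately have "open ((?g -` {0<..} \<inter> ?U) \<inter> {z. cmod (z $ 2) < 1})" by blast
  also have "\<dots> = \<Omega>" by (auto simp: mem_hartogs)
  finally show ?thesis .
qed

lemma hartogs_axis: "0 < cmod w \<Longrightarrow> cmod w < 1 \<Longrightarrow> pt 0 w \<in> \<Omega>"
  by (simp add: mem_hartogs)

lemma hartogs_sets [measurable, simp]: "\<Omega> \<in> sets borel" "\<Omega> \<in> sets lebesgue"
  using open_hartogs by auto

text \<open>
  Averaging uses the joint measurability of the integrand composed with a family of maps, which
  composition yields for Borel functions but not for Lebesgue measurable ones; hence the passage
  to \<open>lborel\<close>.
\<close>
lemma lebesgue_on_hartogs_conv_lborel: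
  fixes G :: "complex^2 \<Rightarrow> 'b::{banach,second_countable_topology}"
  assumes cont: "continuous_on \<Omega> G"
  shows "integrable (lebesgue_on \<Omega>) G \<longleftrightarrow> integrable lborel (\<lambda>z. indicator \<Omega> z *\<^sub>R G z)"
    and "integral\<^sup>L (lebesgue_on \<Omega>) G = (\<integral>z. indicator \<Omega> z *\<^sub>R G z \<partial>lborel)"
proof -
  have m: "(\<lambda>z. indicator \<Omega> z *\<^sub>R G z) \<in> borel_measurable lborel"
    using borel_measurable_continuous_on_indicator[OF _ cont] by simp
  show "integrable (lebesgue_on \<Omega>) G \<longleftrightarrow> integrable lborel (\<lambda>z. indicator \<Omega> z *\<^sub>R G z)"
    using integrable_completion[OF m] by (simp add: integrable_restrict_space)
  show "integral\<^sup>L (lebesgue_on \<Omega>) G = (\<integral>z. indicator \<Omega> z *\<^sub>R G z \<partial>lborel)"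
    using integral_completion[OF m] by (simp add: integral_restrict_space)
qed

lemma continuous_on_hartogs_radial:
  fixes u :: "real \<Rightarrow> real"
  assumes "continuous_on {0<..<1} u"
  shows "continuous_on \<Omega> (\<lambda>z. u (cmod (z $ 2)))"
  by (rule continuous_on_compose2[OF assms]) (auto intro!: continuous_intros simp: mem_hartogs)

lemma rotation_measurable:
  "(\<lambda>(t, z). \<chi> i. (if i = j then rot t else 1) * z $ i)
     \<in> borel_measurable (borel \<Otimes>\<^sub>M (borel :: (complex^2) measure))"
proof -
  have "continuous_on UNIV (\<lambda>p :: real \<times> (complex^2). \<chi> i. (if i = j then rot (fst p) else 1) * snd p $ i)"
  proof (rule continuous_on_vec_lambda)
    fix i
    show "continuous_on UNIV (\<lambda>p :: real \<times> (complex^2). (if i = j then rot (fst p) else 1) * snd p $ i)"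
      by (cases "i = j") (auto intro!: continuous_intros)
  qed
  then show ?thesis
    by (simp add: borel_prod case_prod_beta borel_measurable_continuous_onI)
qed

lemma holomorphic_axis_slice:
  assumes "holomorphic_several k \<Omega>"
  shows "(\<lambda>w. k (pt 0 w)) holomorphic_on ball 0 1 - {0}"
proof -
  have e: "pt 0 w = 0 + w *s pt 0 1" for w by (simp add: vec_eq_iff forall_2)
  show ?thesis
    by (subst e, rule holomorphic_several_on_line[OF assms]) (auto simp: mem_hartogs)
qed

section \<open>Integrating a holomorphic function against a radial weight\<close>

text \<open>
  Two successive averages over rotations. Rotating the first coordinate replaces \<open>k z\<close> by its
  value at the centre of the disc in which \<open>z $ 1\<close> varies. Rotating the second coordinate then
  leaves the constant Laurent coefficient of \<open>k (pt 0 w)\<close>, which is the residue below. The weight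
  is invariant under both rotations.
\<close>
lemma integral_radial_times_holomorphic:
  assumes hol: "holomorphic_several k \<Omega>" and u: "continuous_on {0<..<1} u"
    and int: "integrable (lebesgue_on \<Omega>) (\<lambda>z. of_real (u (cmod (z $ 2))) * k z)"
  shows "(\<integral>z. of_real (u (cmod (z $ 2))) * k z \<partial>lebesgue_on \<Omega>)
       = of_real (\<integral>z. u (cmod (z $ 2)) \<partial>lebesgue_on \<Omega>) * residue (\<lambda>w. k (pt 0 w) / w) 0"
proof -
  let ?C = "residue (\<lambda>w. k (pt 0 w) / w) 0"
  let ?u = "\<lambda>z::complex^2. complex_of_real (u (cmod (z $ 2)))"
  define F0 F1 where "F0 = (\<lambda>z. indicator \<Omega> z *\<^sub>R (?u z * k z))"
    and "F1 = (\<lambda>z. indicator \<Omega> z *\<^sub>R (?u z * k (pt 0 (z $ 2))))"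
  define R where "R = (\<lambda>j t z. (\<chi> i. (if i = j then rot t else 1) * z $ i) :: complex^2)"
  have Rmeas: "(\<lambda>(t, z). R j t z) \<in> borel_measurable (borel \<Otimes>\<^sub>M borel)" for j
    unfolding R_def by (rule rotation_measurable)
  have Rinv: "distr lborel borel (R j t) = lborel" for j t
  proof -
    have "j = 1 \<or> j = 2" by (rule exhaust_2)
    then have "R j t = (\<lambda>z. \<chi> i. (if i = 1 then (if j = 1 then rot t else 1) else
        (if j = 2 then rot t else 1)) * z $ i)"
      by (auto simp: R_def fun_eq_iff vec_eq_iff forall_2)
    then show ?thesis by (simp only:) (rule lborel_distr_unitary_diagonal, auto)
  qed
  have ck: "continuous_on \<Omega> (\<lambda>z. ?u z * k z)"
    by (intro continuous_intros holomorphic_several_imp_continuous_on[OF hol]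
        continuous_on_hartogs_radial[OF u])
  have i0: "integrable lborel F0"
    using int lebesgue_on_hartogs_conv_lborel(1)[OF ck] by (simp add: F0_def)
  have k1: "(\<lambda>\<zeta>. k (pt \<zeta> w)) holomorphic_on ball 0 (exp (- 1 / cmod w))"
    if "0 < cmod w" "cmod w < 1" for w
  proof -
    have e: "pt \<zeta> w = pt 0 w + \<zeta> *s pt 1 0" for \<zeta> by (simp add: vec_eq_iff forall_2)
    show ?thesis
      by (subst e, rule holomorphic_several_on_line[OF hol]) (use that in \<open>auto simp: mem_hartogs\<close>)
  qed
  note k2 = holomorphic_axis_slice[OF hol]
  have m1: "(\<integral>t. F0 (R 1 t z) \<partial>lebesgue_on {0..1}) = F1 z" for z
  proof (cases "z \<in> \<Omega>")
    case True
    have "R 1 t z = pt (rot t * z $ 1) (z $ 2)" for t by (simp add: R_def vec_eq_iff forall_2)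
    then have "F0 (R 1 t z) = ?u z * k (pt (rot t * z $ 1) (z $ 2))" for t
      using True by (simp add: F0_def mem_hartogs norm_mult)
    then have "(\<integral>t. F0 (R 1 t z) \<partial>lebesgue_on {0..1}) = ?u z * circle_mean (\<lambda>\<zeta>. k (pt \<zeta> (z $ 2))) (z $ 1)"
      by (simp add: circle_mean_def)
    also have "circle_mean (\<lambda>\<zeta>. k (pt \<zeta> (z $ 2))) (z $ 1) = k (pt 0 (z $ 2))"
      by (rule circle_mean_disc[OF k1]) (use True in \<open>auto simp: mem_hartogs\<close>)
    finally show ?thesis using True by (simp add: F1_def)
  next
    case False
    then have "R 1 t z \<notin> \<Omega>" for t by (simp add: R_def mem_hartogs norm_mult)
    then show ?thesis using False by (simp add: F0_def F1_def)
  qed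
  have m2: "(\<integral>t. F1 (R 2 t z) \<partial>lebesgue_on {0..1}) = indicator \<Omega> z *\<^sub>R (?u z * ?C)" for z
  proof (cases "z \<in> \<Omega>")
    case True
    then have "F1 (R 2 t z) = ?u z * k (pt 0 (rot t * z $ 2))" for t
      by (simp add: F1_def R_def mem_hartogs norm_mult)
    then have "(\<integral>t. F1 (R 2 t z) \<partial>lebesgue_on {0..1}) = ?u z * circle_mean (\<lambda>w. k (pt 0 w)) (z $ 2)"
      by (simp add: circle_mean_def)
    also have "circle_mean (\<lambda>w. k (pt 0 w)) (z $ 2) = ?C"
      by (rule circle_mean_punctured_disc[OF k2]) (use True in \<open>auto simp: mem_hartogs\<close>)
    finally show ?thesis using True by simp
  next
    case False
    then have "R 2 t z \<notin> \<Omega>" for t by (simp add: R_def mem_hartogs norm_mult)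
    then show ?thesis using False by (simp add: F1_def)
  qed
  note avg0 = integral_average_over_flow[OF i0 Rmeas Rinv, of 1, unfolded m1]
  note avg1 = integral_average_over_flow[OF avg0(1) Rmeas Rinv, of 2, unfolded m2]
  have "(\<integral>z. ?u z * k z \<partial>lebesgue_on \<Omega>) = (\<integral>z. F0 z \<partial>lborel)"
    unfolding F0_def by (rule lebesgue_on_hartogs_conv_lborel(2)[OF ck])
  also have "\<dots> = (\<integral>z. indicator \<Omega> z *\<^sub>R (?u z * ?C) \<partial>lborel)"
    using avg0(2) avg1(2) by simp
  also have "\<dots> = (\<integral>z. ?u z * ?C \<partial>lebesgue_on \<Omega>)"
    by (rule lebesgue_on_hartogs_conv_lborel(2)[symmetric])
       (intro continuous_intros continuous_on_hartogs_radial[OF u])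
  also have "\<dots> = of_real (\<integral>z. u (cmod (z $ 2)) \<partial>lebesgue_on \<Omega>) * ?C"
    by simp
  finally show ?thesis .
qed

section \<open>Moments of the second coordinate\<close>

lemma power_le_fact_mult_exp:
  fixes x :: real assumes "0 \<le> x"
  shows "x ^ n \<le> fact n * exp x"
proof -
  have "(\<Sum>k\<in>{n}. x ^ k /\<^sub>R fact k) \<le> (\<Sum>k. x ^ k /\<^sub>R fact k)"
    using assms by (intro sum_le_suminf summable_exp_generic) auto
  then show ?thesis by (simp add: exp_def field_simps)
qed

text \<open>
  The set lies in a box whose first complex side has half-length \<open>exp (- m)\<close>, which is where
  the shape of the domain enters.
\<close>
lemma emeasure_hartogs_near_axis:
  "emeasure lborel {z \<in> \<Omega>. real m \<le> 1 / cmod (z $ 2)} \<le> ennreal (16 * exp (- 2 * real m))"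
proof -
  let ?e = "exp (- real m)"
  let ?v = "pt (Complex ?e ?e) (Complex 1 1)"
  have B: "(Basis :: (complex^2) set) = {axis 1 1, axis 1 \<i>, axis 2 1, axis 2 \<i>}"
    by (auto simp: Basis_vec_def Basis_complex_def UNIV_2)
  have "{z \<in> \<Omega>. real m \<le> 1 / cmod (z $ 2)} \<subseteq> cbox (- ?v) ?v"
  proof
    fix z assume "z \<in> {z \<in> \<Omega>. real m \<le> 1 / cmod (z $ 2)}"
    then have z: "cmod (z $ 1) < exp (- (1 / cmod (z $ 2)))" "cmod (z $ 2) < 1" "real m \<le> 1 / cmod (z $ 2)"
      by (auto simp: mem_hartogs)
    then have "cmod (z $ 1) \<le> ?e" by (meson exp_le_cancel_iff less_eq_real_def neg_le_iff_le order_trans)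
    then have "\<bar>Re (z $ 1)\<bar> \<le> ?e" "\<bar>Im (z $ 1)\<bar> \<le> ?e" "\<bar>Re (z $ 2)\<bar> \<le> 1" "\<bar>Im (z $ 2)\<bar> \<le> 1"
      using z abs_Re_le_cmod[of "z $ 1"] abs_Im_le_cmod[of "z $ 1"]
        abs_Re_le_cmod[of "z $ 2"] abs_Im_le_cmod[of "z $ 2"] by linarith+
    then show "z \<in> cbox (- ?v) ?v"
      by (auto simp: mem_box B inner_axis abs_le_iff)
  qed
  then have "emeasure lborel {z \<in> \<Omega>. real m \<le> 1 / cmod (z $ 2)} \<le> emeasure lborel (cbox (- ?v) ?v)"
    by (rule emeasure_mono) simp
  also have "\<dots> = ennreal (\<Prod>b\<in>Basis. (?v - - ?v) \<bullet> b)"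
    by (rule emeasure_lborel_cbox) (auto simp: B inner_axis)
  also have "(\<Prod>b\<in>Basis. (?v - - ?v) \<bullet> b) = 16 * (?e * ?e)"
    unfolding B by (subst prod.insert; simp add: axis_eq_axis inner_axis complex_eq_iff)+
  also have "?e * ?e = exp (- 2 * real m)" by (simp flip: exp_add)
  finally show ?thesis .
qed

text \<open>
  Cutting the domain into the pieces on which \<open>1 / \<bar>w\<bar>\<close> lies between \<open>m\<close> and \<open>m + 1\<close>, the integral
  is at most the sum of \<open>exp (m + 1)\<close> times the measure of the \<open>m\<close>-th piece, a convergent
  geometric series. This single majorant gives the integrability of all powers of \<open>w\<close>, negative
  ones included.
\<close>
lemma integrable_exp_inverse_hartogs:
  "integrable (lebesgue_on \<Omega>) (\<lambda>z. exp (1 / cmod (z $ 2)))"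
proof -
  have cont: "continuous_on \<Omega> (\<lambda>z. exp (1 / cmod (z $ 2)))"
    by (intro continuous_intros) (auto simp: mem_hartogs)
  let ?A = "\<lambda>m::nat. {z \<in> \<Omega>. real m \<le> 1 / cmod (z $ 2)}"
  have "continuous_on \<Omega> (\<lambda>z. 1 / cmod (z $ 2))"
    by (intro continuous_intros) (auto simp: mem_hartogs)
  then have Am[measurable]: "?A m \<in> sets borel" for m
  proof -
    have "(\<lambda>z. indicator \<Omega> z *\<^sub>R (1 / cmod (z $ 2))) \<in> borel_measurable borel"
      using \<open>continuous_on \<Omega> (\<lambda>z. 1 / cmod (z $ 2))\<close>
      by (rule borel_measurable_continuous_on_indicator[rotated]) simp
    then have "(\<lambda>z::complex^2. 1 / cmod (z $ 2)) \<in> borel_measurable (restrict_space borel \<Omega>)"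
      by (subst borel_measurable_restrict_space_iff) simp_all
    then have "{z \<in> space (restrict_space borel \<Omega>). real m \<le> 1 / cmod (z $ 2)} \<in> sets (restrict_space borel \<Omega>)"
      by measurable
    then show ?thesis
      by (simp add: space_restrict_space sets_restrict_space_iff)
  qed
  have "(\<integral>\<^sup>+z. ennreal (norm (indicator \<Omega> z *\<^sub>R exp (1 / cmod (z $ 2)))) \<partial>lborel)
      \<le> (\<integral>\<^sup>+z. (\<Sum>m. ennreal (exp (real m + 1)) * indicator (?A m) z) \<partial>lborel)"
  proof (rule nn_integral_mono)
    fix z :: "complex^2"
    show "ennreal (norm (indicator \<Omega> z *\<^sub>R exp (1 / cmod (z $ 2))))
        \<le> (\<Sum>m. ennreal (exp (real m + 1)) * indicator (?A m) z)"
    proof (cases "z \<in> \<Omega>")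
      case True
      define m where "m = nat \<lfloor>1 / cmod (z $ 2)\<rfloor>"
      have m: "real m \<le> 1 / cmod (z $ 2)" "1 / cmod (z $ 2) \<le> real m + 1"
        unfolding m_def by (auto simp: of_nat_nat le_floor_iff)
      have "ennreal (norm (indicator \<Omega> z *\<^sub>R exp (1 / cmod (z $ 2)))) \<le>
          (\<Sum>j\<in>{m}. ennreal (exp (real j + 1)) * indicator (?A j) z)"
        using True m by (simp add: ennreal_leI)
      also have "\<dots> \<le> (\<Sum>m. ennreal (exp (real m + 1)) * indicator (?A m) z)"
        by (rule sum_le_suminf) auto
      finally show ?thesis .
    qed simp
  qed
  also have "\<dots> = (\<Sum>m. ennreal (exp (real m + 1)) * emeasure lborel (?A m))"
    by (subst nn_integral_suminf) (auto simp: nn_integral_cmult_indicator)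
  also have "\<dots> \<le> (\<Sum>m. ennreal (16 * exp 1 * exp (-1) ^ m))"
  proof (rule suminf_le)
    fix m
    have "ennreal (exp (real m + 1)) * emeasure lborel (?A m) \<le>
        ennreal (exp (real m + 1)) * ennreal (16 * exp (- 2 * real m))"
      by (intro mult_left_mono emeasure_hartogs_near_axis) auto
    also have "\<dots> = ennreal (16 * exp 1 * exp (-1) ^ m)"
    proof -
      have "exp (real m + 1) * (16 * exp (- 2 * real m)) = 16 * exp 1 * exp (-1) ^ m"
        by (simp flip: exp_add exp_of_nat_mult)
      then show ?thesis by (simp flip: ennreal_mult)
    qed
    finally show "ennreal (exp (real m + 1)) * emeasure lborel (?A m) \<le> ennreal (16 * exp 1 * exp (-1) ^ m)" .
  qed auto
  also have "\<dots> < \<infinity>"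
  proof -
    have "summable (\<lambda>m. 16 * exp 1 * exp (-1) ^ m :: real)"
      by (intro summable_mult summable_geometric) simp
    then show ?thesis by (subst suminf_ennreal2) auto
  qed
  finally have fin: "(\<integral>\<^sup>+z. ennreal (norm (indicator \<Omega> z *\<^sub>R exp (1 / cmod (z $ 2)))) \<partial>lborel) < \<infinity>" .
  show ?thesis
    unfolding lebesgue_on_hartogs_conv_lborel(1)[OF cont]
    by (rule integrableI_bounded) (use fin borel_measurable_continuous_on_indicator[OF _ cont] in auto)
qed

lemma integrable_hartogs_exp_bound:
  fixes f :: "complex^2 \<Rightarrow> 'b::{banach,second_countable_topology}"
  assumes cont: "continuous_on \<Omega> f" and le: "\<And>z. z \<in> \<Omega> \<Longrightarrow> norm (f z) \<le> C * exp (1 / cmod (z $ 2))"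
  shows "integrable (lebesgue_on \<Omega>) f"
proof (rule Bochner_Integration.integrable_bound)
  show "integrable (lebesgue_on \<Omega>) (\<lambda>z. C * exp (1 / cmod (z $ 2)))"
    using integrable_exp_inverse_hartogs by simp
  show "f \<in> borel_measurable (lebesgue_on \<Omega>)"
    by (rule continuous_imp_measurable_on_sets_lebesgue[OF cont]) simp
  show "AE z in lebesgue_on \<Omega>. norm (f z) \<le> norm (C * exp (1 / cmod (z $ 2)))"
    using le by (intro AE_I2) (auto intro: order_trans[OF _ abs_ge_self])
qed

lemma integrable_moment:
  "integrable (lebesgue_on \<Omega>) (\<lambda>z. (cmod (z $ 2) powi n)\<^sup>2)"
proof (rule integrable_hartogs_exp_bound)
  show "continuous_on \<Omega> (\<lambda>z. (cmod (z $ 2) powi n)\<^sup>2)"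
    by (intro continuous_intros) (auto simp: mem_hartogs)
  fix z assume "z \<in> \<Omega>"
  then have z: "0 < cmod (z $ 2)" "cmod (z $ 2) < 1" by (auto simp: mem_hartogs)
  let ?x = "1 / cmod (z $ 2)" and ?m = "2 * nat (- n)"
  have "(cmod (z $ 2) powi n)\<^sup>2 \<le> ?x ^ ?m"
  proof (cases "n \<ge> 0")
    case True
    then have "cmod (z $ 2) powi n = cmod (z $ 2) ^ nat n" by (simp add: power_int_def)
    then have "(cmod (z $ 2) powi n)\<^sup>2 \<le> 1" using z by (simp add: power_le_one)
    then show ?thesis using True by simp
  next
    case False
    then show ?thesis by (simp add: power_int_def power_mult power_inverse power_one_over inverse_eq_divide power_mult_distrib mult.commute flip: power_mult)
  qed
  also have "\<dots> \<le> fact ?m * exp ?x" by (rule power_le_fact_mult_exp) simp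
  finally show "norm ((cmod (z $ 2) powi n)\<^sup>2) \<le> fact ?m * exp (1 / cmod (z $ 2))" by simp
qed

definition moment :: "int \<Rightarrow> real" where
  "moment n = (\<integral>z. (cmod (z $ 2) powi n)\<^sup>2 \<partial>lebesgue_on \<Omega>)"

lemma hartogs_open_subset_measure_pos:
  assumes "open S" "S \<noteq> {}" "S \<subseteq> \<Omega>"
  shows "measure (lebesgue_on \<Omega>) S > 0"
proof -
  have S: "S \<in> sets lebesgue" using \<open>open S\<close> by auto
  have fin: "emeasure lebesgue \<Omega> < \<infinity>"
    using integrable_moment[of 0] by (simp add: integrable_iff_bounded emeasure_restrict_space space_restrict_space)
  have "emeasure lebesgue S \<noteq> 0"
    using open_not_negligible[OF assms(1,2)] S by (auto simp: negligible_iff_null_sets null_sets_def)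
  moreover have "emeasure lebesgue S \<le> emeasure lebesgue \<Omega>"
    using assms by (intro emeasure_mono) auto
  ultimately have "measure lebesgue S > 0"
    using fin by (simp add: measure_def enn2real_positive_iff less_top top_unique zero_less_iff_neq_zero)
  then show ?thesis using assms S by (simp add: measure_restrict_space)
qed

lemma moment_lower_bound_on_subset:
  assumes "open S" "S \<noteq> {}" "S \<subseteq> \<Omega>" and le: "\<And>z. z \<in> S \<Longrightarrow> \<rho> powi n \<le> cmod (z $ 2) powi n" and "0 < \<rho>"
  shows "measure (lebesgue_on \<Omega>) S * (\<rho> powi n)\<^sup>2 \<le> moment n"
proof -
  have S: "S \<in> sets (lebesgue_on \<Omega>)" using assms by (auto simp: sets_restrict_space_iff)
  have "measure (lebesgue_on \<Omega>) S * (\<rho> powi n)\<^sup>2 = (\<integral>z. (\<rho> powi n)\<^sup>2 * indicator S z \<partial>lebesgue_on \<Omega>)"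
    using S by (simp add: space_restrict_space) (metis Int_absorb2 assms(3) inf_commute mult.commute)
  also have "\<dots> \<le> moment n"
    unfolding moment_def
  proof (rule Bochner_Integration.integral_mono_AE[OF _ integrable_moment])
    have "emeasure (lebesgue_on \<Omega>) S \<le> emeasure (lebesgue_on \<Omega>) \<Omega>"
      by (rule emeasure_mono) (use assms in \<open>auto simp: sets_restrict_space_iff\<close>)
    also have "\<dots> < \<infinity>"
      using integrable_moment[of 0] by (simp add: integrable_iff_bounded space_restrict_space)
    finally show "integrable (lebesgue_on \<Omega>) (\<lambda>z. (\<rho> powi n)\<^sup>2 * indicator S z)"
      using S by (intro integrable_mult_right integrable_real_indicator) auto
    show "AE z in lebesgue_on \<Omega>. (\<rho> powi n)\<^sup>2 * indicator S z \<le> (cmod (z $ 2) powi n)\<^sup>2"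
      using le \<open>0 < \<rho>\<close> by (intro AE_I2) (auto simp: indicator_def intro!: power_mono)
  qed
  finally show ?thesis .
qed

text \<open>
  If \<open>n \<ge> 0\<close>, only the part of the domain with \<open>\<bar>w\<bar> > \<rho>\<close> is kept; if \<open>n < 0\<close>, only the part with
  \<open>\<bar>w\<bar> < \<rho>\<close>. Both parts are nonempty and open. As \<open>\<rho>\<close> is arbitrary, this says that
  \<open>moment (- b)\<close> grows faster than any exponential and \<open>moment b\<close> decays slower than any.
\<close>
lemma moment_lower_bound:
  assumes "0 < \<rho>" "\<rho> < 1"
  obtains v where "v > 0" "\<And>n. v * (\<rho> powi n)\<^sup>2 \<le> moment n"
proof -
  define S T where "S = \<Omega> \<inter> {z. cmod (z $ 2) < \<rho>}" and "T = \<Omega> \<inter> {z. \<rho> < cmod (z $ 2)}"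
  have "pt 0 (of_real (\<rho> / 2)) \<in> S" "pt 0 (of_real ((1 + \<rho>) / 2)) \<in> T"
    using assms by (auto simp: S_def T_def mem_hartogs simp del: of_real_divide of_real_add)
  then have ne: "S \<noteq> {}" "T \<noteq> {}" by auto
  have op: "open S" "open T" unfolding S_def T_def
    by (intro open_Int open_hartogs open_Collect_less continuous_intros)+
  have sub: "S \<subseteq> \<Omega>" "T \<subseteq> \<Omega>" by (auto simp: S_def T_def)
  \<comment> \<open>The minimum serves both signs of \<open>n\<close>.\<close>
  define v where "v = min (measure (lebesgue_on \<Omega>) S) (measure (lebesgue_on \<Omega>) T)"
  have v0: "v > 0" unfolding v_def using hartogs_open_subset_measure_pos op ne sub by simp
  have "v * (\<rho> powi n)\<^sup>2 \<le> moment n" for n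
  proof (cases "n \<ge> 0")
    case True
    have "v * (\<rho> powi n)\<^sup>2 \<le> measure (lebesgue_on \<Omega>) T * (\<rho> powi n)\<^sup>2"
      by (intro mult_right_mono) (auto simp: v_def)
    also have "\<dots> \<le> moment n"
      using op ne sub assms True
      by (intro moment_lower_bound_on_subset) (auto simp: T_def power_int_def intro!: power_mono)
    finally show ?thesis .
  next
    case False
    have "v * (\<rho> powi n)\<^sup>2 \<le> measure (lebesgue_on \<Omega>) S * (\<rho> powi n)\<^sup>2"
      by (intro mult_right_mono) (auto simp: v_def)
    also have "\<dots> \<le> moment n"
      using op ne sub assms False
      by (intro moment_lower_bound_on_subset)
         (auto simp: S_def power_int_def mem_hartogs intro!: power_mono le_imp_inverse_le)
    finally show ?thesis .
  qed
  with v0 show ?thesis using that by blast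
qed

lemma moment_pos: "moment n > 0"
proof -
  obtain v where "v > 0" "\<And>n. v * ((1/2) powi n)\<^sup>2 \<le> moment n"
    using moment_lower_bound[of "1/2"] by auto
  moreover have "v * ((1/2) powi n)\<^sup>2 > 0" using \<open>v > 0\<close> by (simp add: zero_less_power_int)
  ultimately show ?thesis by (metis less_le_trans)
qed

section \<open>Uniqueness of the Bergman projection\<close>

lemma L2_space_iff:
  "f \<in> L2_space S \<longleftrightarrow> f \<in> borel_measurable (lebesgue_on S) \<and> integrable (lebesgue_on S) (\<lambda>z. (cmod (f z))\<^sup>2)"
  by (simp add: L2_space_def)

lemma L2_space_cnj: "f \<in> L2_space S \<Longrightarrow> (\<lambda>z. cnj (f z)) \<in> L2_space S"
  by (auto simp: L2_space_iff intro!: borel_measurable_continuous_on[where f = cnj] continuous_intros)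

lemma L2_space_diff:
  assumes "f \<in> L2_space S" "g \<in> L2_space S"
  shows "(\<lambda>z. f z - g z) \<in> L2_space S"
  unfolding L2_space_iff
proof
  have [measurable]: "f \<in> borel_measurable (lebesgue_on S)" "g \<in> borel_measurable (lebesgue_on S)"
    using assms by (auto simp: L2_space_iff)
  show "(\<lambda>z. f z - g z) \<in> borel_measurable (lebesgue_on S)" by measurable
  show "integrable (lebesgue_on S) (\<lambda>z. (cmod (f z - g z))\<^sup>2)"
  proof (rule Bochner_Integration.integrable_bound)
    show "integrable (lebesgue_on S) (\<lambda>z. 2 * (cmod (f z))\<^sup>2 + 2 * (cmod (g z))\<^sup>2)"
      using assms by (auto simp: L2_space_iff)
    have "(cmod (f z - g z))\<^sup>2 \<le> 2 * (cmod (f z))\<^sup>2 + 2 * (cmod (g z))\<^sup>2" for z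
    proof -
      have "(cmod (f z - g z))\<^sup>2 \<le> (cmod (f z) + cmod (g z))\<^sup>2"
        by (intro power_mono norm_triangle_ineq4) auto
      also have "\<dots> \<le> 2 * (cmod (f z))\<^sup>2 + 2 * (cmod (g z))\<^sup>2"
        using sum_squares_bound[of "cmod (f z)" "cmod (g z)"] by (simp add: power2_sum)
      finally show ?thesis .
    qed
    then show "AE z in lebesgue_on S. norm ((cmod (f z - g z))\<^sup>2) \<le> norm (2 * (cmod (f z))\<^sup>2 + 2 * (cmod (g z))\<^sup>2)"
      by (intro AE_I2) auto
  qed measurable
qed

lemma L2_space_mult_integrable:
  assumes "f \<in> L2_space S" "g \<in> L2_space S"
  shows "integrable (lebesgue_on S) (\<lambda>z. f z * g z)"
proof (rule Bochner_Integration.integrable_bound)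
  have [measurable]: "f \<in> borel_measurable (lebesgue_on S)" "g \<in> borel_measurable (lebesgue_on S)"
    using assms by (auto simp: L2_space_iff)
  show "(\<lambda>z. f z * g z) \<in> borel_measurable (lebesgue_on S)" by measurable
  show "integrable (lebesgue_on S) (\<lambda>z. (cmod (f z))\<^sup>2 + (cmod (g z))\<^sup>2)"
    using assms by (auto simp: L2_space_iff)
  have "cmod (f z) * cmod (g z) \<le> (cmod (f z))\<^sup>2 + (cmod (g z))\<^sup>2" for z
  proof -
    have "2 * (cmod (f z) * cmod (g z)) \<le> (cmod (f z))\<^sup>2 + (cmod (g z))\<^sup>2"
      using sum_squares_bound[of "cmod (f z)" "cmod (g z)"] by (simp add: mult.assoc)
    moreover have "0 \<le> cmod (f z) * cmod (g z)" by simp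
    ultimately show ?thesis by linarith
  qed
  then show "AE z in lebesgue_on S. norm (f z * g z) \<le> norm ((cmod (f z))\<^sup>2 + (cmod (g z))\<^sup>2)"
    by (intro AE_I2) (simp add: norm_mult)
qed

text \<open>
  Two candidates differ by an element of the Bergman space that is orthogonal to itself, hence
  zero almost everywhere on \<open>S\<close>, hence zero on \<open>S\<close> by continuity. Off \<open>S\<close> both vanish by
  convention.
\<close>
lemma bergman_projection_eqI:
  fixes S :: "(complex^'n) set"
  assumes "open S" and g: "g \<in> L2_space S" and h: "h \<in> bergman_space S"
    and off: "\<And>z. z \<notin> S \<Longrightarrow> h z = 0"
    and orth: "\<And>k. k \<in> bergman_space S \<Longrightarrow> L2_inner S (\<lambda>z. g z - h z) k = 0"
  shows "bergman_projection S g = h"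
  unfolding bergman_projection_def
proof (rule the_equality)
  show "h \<in> bergman_space S \<and> (\<forall>z. z \<notin> S \<longrightarrow> h z = 0) \<and> (\<forall>k\<in>bergman_space S. L2_inner S (\<lambda>z. g z - h z) k = 0)"
    using h off orth by blast
next
  fix h' assume h': "h' \<in> bergman_space S \<and> (\<forall>z. z \<notin> S \<longrightarrow> h' z = 0) \<and>
      (\<forall>k\<in>bergman_space S. L2_inner S (\<lambda>z. g z - h' z) k = 0)"
  define d where "d = (\<lambda>z. h z - h' z)"
  have L2: "h \<in> L2_space S" "h' \<in> L2_space S" and hol: "holomorphic_several h S" "holomorphic_several h' S"
    using h h' by (auto simp: bergman_space_def)
  have dL2: "d \<in> L2_space S" and dhol: "holomorphic_several d S"
    unfolding d_def using L2_space_diff[OF L2] holomorphic_several_diff[OF hol] by auto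
  then have d: "d \<in> bergman_space S" by (simp add: bergman_space_def)
  have "(\<integral>z. d z * cnj (d z) \<partial>lebesgue_on S)
      = (\<integral>z. (g z - h' z) * cnj (d z) - (g z - h z) * cnj (d z) \<partial>lebesgue_on S)"
    by (simp add: d_def algebra_simps)
  also have "\<dots> = L2_inner S (\<lambda>z. g z - h' z) d - L2_inner S (\<lambda>z. g z - h z) d"
    unfolding L2_inner_def
    by (intro Bochner_Integration.integral_diff L2_space_mult_integrable L2_space_diff L2_space_cnj g L2 dL2)
  also have "\<dots> = 0" using orth d h' by simp
  finally have "(\<integral>z. complex_of_real ((cmod (d z))\<^sup>2) \<partial>lebesgue_on S) = 0"
    by (simp only: complex_norm_square)
  then have "(\<integral>z. (cmod (d z))\<^sup>2 \<partial>lebesgue_on S) = 0" by (simp only: integral_complex_of_real of_real_eq_0_iff)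
  then have "AE z in lebesgue_on S. (cmod (d z))\<^sup>2 = 0"
    using dL2 by (subst (asm) integral_nonneg_eq_0_iff_AE) (auto simp: L2_space_iff)
  then have ae: "AE z in lebesgue. z \<in> S \<longrightarrow> d z = 0"
    using \<open>open S\<close> by (simp add: AE_restrict_space_iff)
  \<comment> \<open>A null open set is empty.\<close>
  have "open (S \<inter> d -` (- {0}))"
    using holomorphic_several_imp_continuous_on[OF dhol] \<open>open S\<close>
    by (simp add: continuous_on_open_vimage Int_commute open_Compl)
  moreover have "negligible (S \<inter> d -` (- {0}))"
    unfolding negligible_iff_null_sets
  proof (subst AE_iff_null_sets)
    show "S \<inter> d -` (- {0}) \<in> sets lebesgue" using \<open>open (S \<inter> d -` (- {0}))\<close> by auto
    show "AE z in lebesgue. z \<notin> S \<inter> d -` (- {0})" using ae by eventually_elim auto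
  qed
  ultimately have "S \<inter> d -` (- {0}) = {}" using open_not_negligible by blast
  then have "d z = 0" if "z \<in> S" for z using that by auto
  then show "h' = h" using off h' unfolding d_def fun_eq_iff by (metis eq_iff_diff_eq_0)
qed

lemma H_infinity_subset_bergman_space: "H_infinity \<Omega> \<subseteq> bergman_space \<Omega>"
proof
  fix g assume "g \<in> H_infinity \<Omega>"
  then have hol: "holomorphic_several g \<Omega>" and "bounded (g ` \<Omega>)" by (auto simp: H_infinity_def)
  then obtain B where B: "\<And>z. z \<in> \<Omega> \<Longrightarrow> cmod (g z) \<le> B" by (auto simp: bounded_iff)
  have cont: "continuous_on \<Omega> g" by (rule holomorphic_several_imp_continuous_on[OF hol])
  have "integrable (lebesgue_on \<Omega>) (\<lambda>z. (cmod (g z))\<^sup>2)"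
  proof (rule integrable_hartogs_exp_bound)
    show "continuous_on \<Omega> (\<lambda>z. (cmod (g z))\<^sup>2)" by (intro continuous_intros cont)
    fix z assume "z \<in> \<Omega>"
    then have "(cmod (g z))\<^sup>2 \<le> B\<^sup>2" using B by (intro power_mono) auto
    also have "\<dots> \<le> B\<^sup>2 * exp (1 / cmod (z $ 2))" by (simp add: mult_le_cancel_left1)
    finally show "norm ((cmod (g z))\<^sup>2) \<le> B\<^sup>2 * exp (1 / cmod (z $ 2))" by simp
  qed
  moreover have "g \<in> borel_measurable (lebesgue_on \<Omega>)"
    by (rule continuous_imp_measurable_on_sets_lebesgue[OF cont]) simp
  ultimately show "g \<in> bergman_space \<Omega>" using hol by (simp add: bergman_space_def L2_space_iff)
qed

section \<open>Pairing monomials with the Bergman space\<close>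

lemma holomorphic_several_monomial: "holomorphic_several (\<lambda>z. (z $ 2) powi n) \<Omega>"
  by (rule holomorphic_several_component[where T = "- {0}"])
     (auto intro!: holomorphic_intros simp: mem_hartogs)

lemma monomial_in_L2: "(\<lambda>z. (z $ 2) powi n) \<in> L2_space \<Omega>"
  unfolding L2_space_iff
proof
  show "(\<lambda>z. (z $ 2) powi n) \<in> borel_measurable (lebesgue_on \<Omega>)"
    by (intro continuous_imp_measurable_on_sets_lebesgue
        holomorphic_several_imp_continuous_on holomorphic_several_monomial) simp
  show "integrable (lebesgue_on \<Omega>) (\<lambda>z. (cmod ((z $ 2) powi n))\<^sup>2)"
    using integrable_moment by (simp add: norm_power_int)
qed

lemma integral_holomorphic_hartogs:
  assumes hol: "holomorphic_several k \<Omega>" and int: "integrable (lebesgue_on \<Omega>) k"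
  shows "(\<integral>z. k z \<partial>lebesgue_on \<Omega>) = of_real (moment 0) * residue (\<lambda>w. k (pt 0 w) / w) 0"
  using integral_radial_times_holomorphic[OF hol, of "\<lambda>_. 1"] int by (simp add: moment_def)

text \<open>
  On the domain \<open>cnj (w\<^sup>n) k = \<bar>w\<bar>\<^sup>2\<^sup>n (w\<^sup>-\<^sup>n k)\<close>, so both integrals are multiples of the constant
  Laurent coefficient of \<open>w\<^sup>-\<^sup>n k\<close> on the axis, with the weights \<open>\<bar>w\<bar>\<^sup>2\<^sup>n\<close> and \<open>1\<close>. This is
  what makes the projection of the conjugate of \<open>w\<^sup>-\<^sup>n\<close> a multiple of \<open>w\<^sup>n\<close>.
\<close>
lemma integral_cnj_monomial_mult:
  assumes k: "k \<in> bergman_space \<Omega>"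
  shows "of_real (moment 0) * (\<integral>z. cnj ((z $ 2) powi n) * k z \<partial>lebesgue_on \<Omega>)
       = of_real (moment n) * (\<integral>z. (z $ 2) powi (- n) * k z \<partial>lebesgue_on \<Omega>)"
proof -
  let ?q = "\<lambda>z::complex^2. (z $ 2) powi (- n) * k z"
  have hol: "holomorphic_several ?q \<Omega>" and L2: "k \<in> L2_space \<Omega>"
    using k by (auto simp: bergman_space_def intro!: holomorphic_several_mult holomorphic_several_monomial)
  have eq: "cnj ((z $ 2) powi n) * k z = of_real ((cmod (z $ 2) powi n)\<^sup>2) * ?q z" if "z \<in> \<Omega>" for z
  proof -
    have nz: "z $ 2 \<noteq> 0" using that by (auto simp: mem_hartogs)
    have "of_real ((cmod (z $ 2) powi n)\<^sup>2) = (z $ 2) powi n * cnj ((z $ 2) powi n)"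
      by (simp only: complex_norm_square[symmetric] norm_power_int)
    then show ?thesis using nz by (simp add: power_int_minus field_simps)
  qed
  have i1: "integrable (lebesgue_on \<Omega>) ?q"
    by (intro L2_space_mult_integrable monomial_in_L2 L2)
  have "integrable (lebesgue_on \<Omega>) (\<lambda>z. cnj ((z $ 2) powi n) * k z)"
    by (intro L2_space_mult_integrable L2_space_cnj monomial_in_L2 L2)
  then have i2: "integrable (lebesgue_on \<Omega>) (\<lambda>z. of_real ((cmod (z $ 2) powi n)\<^sup>2) * ?q z)"
    by (subst (asm) Bochner_Integration.integrable_cong[OF refl eq]) simp_all
  have "(\<integral>z. cnj ((z $ 2) powi n) * k z \<partial>lebesgue_on \<Omega>)
      = (\<integral>z. of_real ((cmod (z $ 2) powi n)\<^sup>2) * ?q z \<partial>lebesgue_on \<Omega>)"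
    by (rule Bochner_Integration.integral_cong) (use eq in auto)
  also have "\<dots> = of_real (moment n) * residue (\<lambda>w. ?q (pt 0 w) / w) 0"
    unfolding moment_def
    by (rule integral_radial_times_holomorphic[OF hol, of "\<lambda>r. (r powi n)\<^sup>2", OF _ i2])
       (auto intro!: continuous_intros)
  finally show ?thesis
    using integral_holomorphic_hartogs[OF hol i1] by simp
qed

text \<open>
  The residue is a mean over the circle of radius \<open>1 / 4\<close>. That radius is inside the disc of
  radius \<open>1 / 2\<close> on which the bound on the coefficients makes the series converge absolutely, so
  the sum may be taken out of the mean.
\<close>
lemma residue_power_series_mult:
  assumes k: "k holomorphic_on ball 0 1 - {0}" and f: "f holomorphic_on ball 0 1 - {0}"
    and ser: "\<And>w. 0 < cmod w \<Longrightarrow> cmod w < 1 \<Longrightarrow> (\<lambda>b. \<gamma> b * w ^ b) sums f w"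
    and bound: "\<And>b. cmod (\<gamma> b) \<le> B * 2 ^ b"
  shows "(\<lambda>b. \<gamma> b * residue (\<lambda>w. w ^ b * k w / w) 0) sums residue (\<lambda>w. f w * k w / w) 0"
proof -
  let ?q = "1 / 4 :: complex"
  have m: "residue (\<lambda>w. p w / w) 0 = circle_mean p ?q" if "p holomorphic_on ball 0 1 - {0}" for p
    by (rule circle_mean_punctured_disc[symmetric, OF that]) auto
  have contk: "continuous_on (sphere 0 (1 / 4)) k"
    by (rule continuous_on_subset[OF holomorphic_on_imp_continuous_on[OF k]]) auto
  have "bounded (k ` sphere 0 (1 / 4))"
    by (intro compact_imp_bounded compact_continuous_image contk) auto
  then obtain K where "\<forall>w\<in>sphere 0 (1 / 4). cmod (k w) \<le> K" by (auto simp: bounded_iff)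
  then have K: "cmod (k w) \<le> K" if "cmod w = 1 / 4" for w using that by (metis mem_sphere_0)
  have int: "integrable (lebesgue_on {0..1}) (\<lambda>t. \<gamma> b * ((rot t * ?q) ^ b * k (rot t * ?q)))" for b
  proof -
    have "continuous_on (sphere 0 (cmod ?q)) (\<lambda>w. w ^ b * k w)"
      using contk by (auto intro!: continuous_intros)
    from circle_mean_conv_integral(2)[OF this] show ?thesis by simp
  qed
  have le: "norm (\<gamma> b * ((rot t * ?q) ^ b * k (rot t * ?q))) \<le> B * K * (1 / 2) ^ b" for b t
  proof -
    have "norm (\<gamma> b * ((rot t * ?q) ^ b * k (rot t * ?q))) = cmod (\<gamma> b) * ((1 / 4) ^ b * cmod (k (rot t * ?q)))"
      by (simp add: norm_mult norm_power norm_divide)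
    also have "\<dots> \<le> (B * 2 ^ b) * ((1 / 4) ^ b * K)"
      using bound[of b] K[of "rot t * ?q"] order_trans[OF norm_ge_zero bound[of b]]
      by (intro mult_mono) (auto simp: norm_mult norm_divide)
    also have "\<dots> = B * K * (1 / 2) ^ b"
    proof -
      have "(4 :: real) ^ b = 2 ^ b * 2 ^ b" by (simp flip: power_mult_distrib)
      then show ?thesis by (simp add: power_divide)
    qed
    finally show ?thesis .
  qed
  have sm: "summable (\<lambda>b. B * K * (1 / 2) ^ b)" by (intro summable_mult summable_geometric) simp
  have "(\<lambda>b. \<integral>t. \<gamma> b * ((rot t * ?q) ^ b * k (rot t * ?q)) \<partial>lebesgue_on {0..1})
      sums (\<integral>t. (\<Sum>b. \<gamma> b * ((rot t * ?q) ^ b * k (rot t * ?q))) \<partial>lebesgue_on {0..1})"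
  proof (rule sums_integral[OF int])
    show "AE t in lebesgue_on {0..1}. summable (\<lambda>b. norm (\<gamma> b * ((rot t * ?q) ^ b * k (rot t * ?q))))"
      by (intro AE_I2 summable_comparison_test'[OF sm, of 0]) (use le in auto)
    have "(\<integral>t. norm (\<gamma> b * ((rot t * ?q) ^ b * k (rot t * ?q))) \<partial>lebesgue_on {0..1}) \<le>
        (\<integral>t. B * K * (1 / 2) ^ b \<partial>lebesgue_on {0..1::real})" for b
      by (rule Bochner_Integration.integral_mono[OF integrable_norm[OF int]]) (use le in simp_all)
    then show "summable (\<lambda>b. \<integral>t. norm (\<gamma> b * ((rot t * ?q) ^ b * k (rot t * ?q))) \<partial>lebesgue_on {0..1})"
      by (intro summable_comparison_test'[OF sm, of 0]) (auto simp: measure_restrict_space)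
  qed
  moreover have "(\<integral>t. \<gamma> b * ((rot t * ?q) ^ b * k (rot t * ?q)) \<partial>lebesgue_on {0..1})
      = \<gamma> b * residue (\<lambda>w. w ^ b * k w / w) 0" for b
    by (subst m) (auto intro!: holomorphic_intros k simp: circle_mean_def)
  moreover have "(\<Sum>b. \<gamma> b * ((rot t * ?q) ^ b * k (rot t * ?q))) = f (rot t * ?q) * k (rot t * ?q)" for t
    using sums_mult2[OF ser[of "rot t * ?q"], of "k (rot t * ?q)"]
    by (simp add: norm_mult norm_divide sums_iff mult.assoc)
  moreover have "residue (\<lambda>w. f w * k w / w) 0 = (\<integral>t. f (rot t * ?q) * k (rot t * ?q) \<partial>lebesgue_on {0..1})"
    by (subst m) (auto intro!: holomorphic_intros k f simp: circle_mean_def)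
  ultimately show ?thesis by (simp only:)
qed

text \<open>
  Riemann's removable singularity theorem for \<open>g (pt 0 w)\<close>, followed by Cauchy's inequality on the
  circle of radius \<open>1 / 2\<close>. The factor \<open>2 ^ b\<close> is harmless because the moments beat every
  exponential.
\<close>
lemma H_infinity_axis_power_series:
  assumes g: "holomorphic_several g \<Omega>" and B: "\<And>z. z \<in> \<Omega> \<Longrightarrow> cmod (g z) \<le> B"
  obtains \<gamma> where "\<And>w. 0 < cmod w \<Longrightarrow> cmod w < 1 \<Longrightarrow> (\<lambda>b. \<gamma> b * w ^ b) sums g (pt 0 w)"
    and "\<And>b. cmod (\<gamma> b) \<le> B * 2 ^ b"
proof -
  have slice: "(\<lambda>w. g (pt 0 w)) holomorphic_on ball 0 1 - {0}"
    by (rule holomorphic_axis_slice[OF g])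
  have bd: "cmod (g (pt 0 w)) \<le> B" if "w \<in> ball 0 1 - {0}" for w
    using that by (intro B) (auto simp: mem_hartogs)
  have "eventually (\<lambda>w. w \<in> ball 0 1 - {0}) (at (0::complex))"
    by (intro eventually_at_in_open) auto
  then have "eventually (\<lambda>w. cmod (g (pt 0 w)) \<le> B) (at 0)"
    by eventually_elim (rule bd)
  then obtain G where G: "G holomorphic_on ball 0 1" and eq: "\<And>w. w \<in> ball 0 1 - {0} \<Longrightarrow> G w = g (pt 0 w)"
    using holomorphic_on_extend_bounded[OF slice] by auto
  define \<gamma> where "\<gamma> b = (deriv ^^ b) G 0 / fact b" for b
  have "(\<lambda>b. \<gamma> b * w ^ b) sums g (pt 0 w)" if "0 < cmod w" "cmod w < 1" for w
    using holomorphic_power_series[OF G, of w] eq[of w] that by (simp add: \<gamma>_def)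
  moreover have "cmod (\<gamma> b) \<le> B * 2 ^ b" for b
  proof -
    have "cmod ((deriv ^^ b) G 0) \<le> fact b * B / (1 / 2) ^ b"
    proof (rule Cauchy_inequality)
      show "G holomorphic_on ball 0 (1 / 2)" by (rule holomorphic_on_subset[OF G]) auto
      show "continuous_on (cball 0 (1 / 2)) G"
        by (rule continuous_on_subset[OF holomorphic_on_imp_continuous_on[OF G]]) auto
      show "cmod (G w) \<le> B" if "cmod (0 - w) = 1 / 2" for w
      proof -
        have "w \<in> ball 0 1 - {0}" using that by auto
        then show ?thesis using eq bd by metis
      qed
    qed simp
    then show ?thesis by (simp add: \<gamma>_def norm_divide field_simps)
  qed
  ultimately show ?thesis by (rule that)
qed

text \<open>
  The terms of the power series need not be absolutely summable against \<open>k\<close> over the whole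
  domain, as nothing controls them near \<open>\<bar>w\<bar> = 1\<close>. Both sides are therefore
  first reduced to residues, where a small circle can be used.
\<close>
lemma integral_mult_axis_power_series:
  assumes g: "holomorphic_several g \<Omega>" and k: "k \<in> bergman_space \<Omega>"
    and int: "integrable (lebesgue_on \<Omega>) (\<lambda>z. g z * k z)"
    and ser: "\<And>w. 0 < cmod w \<Longrightarrow> cmod w < 1 \<Longrightarrow> (\<lambda>b. \<gamma> b * w ^ b) sums g (pt 0 w)"
    and bound: "\<And>b. cmod (\<gamma> b) \<le> B * 2 ^ b"
  shows "(\<lambda>b. \<gamma> b * (\<integral>z. (z $ 2) powi int b * k z \<partial>lebesgue_on \<Omega>)) sums (\<integral>z. g z * k z \<partial>lebesgue_on \<Omega>)"
proof -
  have hk: "holomorphic_several k \<Omega>" and L2: "k \<in> L2_space \<Omega>" using k by (auto simp: bergman_space_def)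
  have "(\<lambda>b. \<gamma> b * residue (\<lambda>w. w ^ b * k (pt 0 w) / w) 0) sums residue (\<lambda>w. g (pt 0 w) * k (pt 0 w) / w) 0"
    by (rule residue_power_series_mult[OF holomorphic_axis_slice[OF hk] holomorphic_axis_slice[OF g] ser bound])
  from sums_mult[OF this, of "of_real (moment 0)"] show ?thesis
    using integral_holomorphic_hartogs[OF holomorphic_several_mult[OF g hk] int]
      integral_holomorphic_hartogs[OF holomorphic_several_mult[OF holomorphic_several_monomial hk]
        L2_space_mult_integrable[OF monomial_in_L2 L2], of "int _"]
    by (simp add: mult_ac)
qed

section \<open>Series of monomials with square-root moment weights\<close>

lemma suminf_weighted_Cauchy_Schwarz:
  fixes \<alpha> t x :: "nat \<Rightarrow> real"
  assumes nn: "\<And>b. \<alpha> b \<ge> 0" "\<And>b. t b > 0"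
    and s1: "summable (\<lambda>b. \<alpha> b * t b)" and s2: "summable (\<lambda>b. \<alpha> b * (x b)\<^sup>2 / t b)"
    and s: "summable (\<lambda>b. \<alpha> b * x b)"
  shows "(\<Sum>b. \<alpha> b * x b)\<^sup>2 \<le> (\<Sum>b. \<alpha> b * t b) * (\<Sum>b. \<alpha> b * (x b)\<^sup>2 / t b)"
proof (rule LIMSEQ_le_const2)
  show "(\<lambda>N. (\<Sum>b<N. \<alpha> b * x b)\<^sup>2) \<longlonglongrightarrow> (\<Sum>b. \<alpha> b * x b)\<^sup>2"
    by (intro tendsto_power summable_LIMSEQ s)
  have "(\<Sum>b<N. \<alpha> b * x b)\<^sup>2 \<le> (\<Sum>b. \<alpha> b * t b) * (\<Sum>b. \<alpha> b * (x b)\<^sup>2 / t b)" for N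
  proof -
    have "(\<Sum>b<N. \<alpha> b * x b)\<^sup>2 = (\<Sum>b<N. sqrt (\<alpha> b * t b) * (sqrt (\<alpha> b / t b) * x b))\<^sup>2"
    proof -
      have "\<alpha> b * x b = sqrt (\<alpha> b * t b) * (sqrt (\<alpha> b / t b) * x b)" for b
      proof -
        have "sqrt (\<alpha> b * t b) * sqrt (\<alpha> b / t b) = sqrt ((\<alpha> b)\<^sup>2)"
          using nn(2)[of b] by (simp flip: real_sqrt_mult add: power2_eq_square)
        then show ?thesis using nn(1)[of b] by (simp flip: mult.assoc)
      qed
      then show ?thesis by (intro arg_cong[where f = "\<lambda>y. y\<^sup>2"] sum.cong refl)
    qed
    also have "\<dots> \<le> (\<Sum>b<N. (sqrt (\<alpha> b * t b))\<^sup>2) * (\<Sum>b<N. (sqrt (\<alpha> b / t b) * x b)\<^sup>2)"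
      by (rule Cauchy_Schwarz_ineq_sum)
    also have "\<dots> = (\<Sum>b<N. \<alpha> b * t b) * (\<Sum>b<N. \<alpha> b * (x b)\<^sup>2 / t b)"
      using nn less_imp_le[OF nn(2)] by (simp add: power_mult_distrib)
    also have "\<dots> \<le> (\<Sum>b. \<alpha> b * t b) * (\<Sum>b. \<alpha> b * (x b)\<^sup>2 / t b)"
      using nn less_imp_le[OF nn(2)]
      by (intro mult_mono sum_le_suminf s1 s2 sum_nonneg suminf_nonneg) auto
    finally show ?thesis .
  qed
  then show "\<exists>N. \<forall>n\<ge>N. (\<Sum>b<n. \<alpha> b * x b)\<^sup>2 \<le> (\<Sum>b. \<alpha> b * t b) * (\<Sum>b. \<alpha> b * (x b)\<^sup>2 / t b)"
    by blast
qed

text \<open>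
  The value off the domain is the one that the Bergman projection prescribes there. Exponents are
  arbitrary integers so that series in \<open>w\<close> and in \<open>1 / w\<close> are treated together.
\<close>
definition monomial_series :: "(nat \<Rightarrow> complex) \<Rightarrow> (nat \<Rightarrow> int) \<Rightarrow> complex^2 \<Rightarrow> complex" where
  "monomial_series a e z = (if z \<in> \<Omega> then \<Sum>b. a b * (z $ 2) powi e b else 0)"

text \<open>
  The square root of \<open>moment n\<close> is the \<open>L\<^sup>2\<close> norm of \<open>w\<^sup>n\<close>, so the hypothesis is absolute convergence
  in \<open>L\<^sup>2\<close>. By the lower bound on the moments it forces pointwise convergence.
\<close>
lemma summable_monomial_coefficients:
  assumes sm: "summable (\<lambda>b. cmod (a b) * sqrt (moment (e b)))" and \<rho>: "0 < \<rho>" "\<rho> < 1"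
  shows "summable (\<lambda>b. cmod (a b) * \<rho> powi e b)"
    and "summable (\<lambda>b. cmod (a b) * (\<rho> powi e b)\<^sup>2 / sqrt (moment (e b)))"
proof -
  obtain v where v: "v > 0" "\<And>n. v * (\<rho> powi n)\<^sup>2 \<le> moment n" using moment_lower_bound[OF \<rho>] by blast
  have le: "(\<rho> powi n)\<^sup>2 \<le> moment n / v" for n using v by (simp add: field_simps)
  show "summable (\<lambda>b. cmod (a b) * \<rho> powi e b)"
  proof (rule summable_comparison_test'[where N = 0])
    show "summable (\<lambda>b. (cmod (a b) * sqrt (moment (e b))) / sqrt v)" by (intro summable_divide sm)
    fix b
    have "\<rho> powi e b \<le> sqrt (moment (e b) / v)" using le by (rule real_le_rsqrt)
    then have "cmod (a b) * \<rho> powi e b \<le> cmod (a b) * (sqrt (moment (e b)) / sqrt v)"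
      by (intro mult_left_mono) (auto simp: real_sqrt_divide)
    then show "norm (cmod (a b) * \<rho> powi e b) \<le> (cmod (a b) * sqrt (moment (e b))) / sqrt v"
      using \<rho> by (simp add: abs_mult)
  qed
  show "summable (\<lambda>b. cmod (a b) * (\<rho> powi e b)\<^sup>2 / sqrt (moment (e b)))"
  proof (rule summable_comparison_test'[where N = 0])
    show "summable (\<lambda>b. (cmod (a b) * sqrt (moment (e b))) / v)" by (intro summable_divide sm)
    fix b
    have "cmod (a b) * (\<rho> powi e b)\<^sup>2 / sqrt (moment (e b)) \<le> cmod (a b) * (moment (e b) / v) / sqrt (moment (e b))"
      using moment_pos[of "e b"] by (intro divide_right_mono mult_left_mono le) auto
    also have "\<dots> = cmod (a b) * (moment (e b) / sqrt (moment (e b))) / v" by simp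
    also have "\<dots> = (cmod (a b) * sqrt (moment (e b))) / v"
      using moment_pos[of "e b"] by (simp only: real_div_sqrt less_imp_le)
    finally show "norm (cmod (a b) * (\<rho> powi e b)\<^sup>2 / sqrt (moment (e b))) \<le> (cmod (a b) * sqrt (moment (e b))) / v"
      using moment_pos[of "e b"] by (simp add: abs_mult)
  qed
qed

text \<open>
  Gives one majorant on an annulus for either sign of the exponent.
\<close>
lemma power_int_le_sum_endpoints:
  fixes x r1 r2 :: real
  assumes "0 < r1" "r1 \<le> x" "x \<le> r2"
  shows "x powi n \<le> r1 powi n + r2 powi n"
proof (cases "n \<ge> 0")
  case True
  then have "x powi n \<le> r2 powi n" using assms by (auto simp: power_int_def intro!: power_mono)
  moreover have "0 \<le> r1 powi n" using assms by simp
  ultimately show ?thesis by linarith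
next
  case False
  then have "x powi n \<le> r1 powi n"
    using assms by (auto simp: power_int_def intro!: power_mono le_imp_inverse_le)
  moreover have "0 \<le> r2 powi n" using assms by simp
  ultimately show ?thesis by linarith
qed

lemma holomorphic_monomial_series:
  assumes sm: "\<And>\<rho>. 0 < \<rho> \<Longrightarrow> \<rho> < 1 \<Longrightarrow> summable (\<lambda>b. cmod (a b) * \<rho> powi e b)"
  shows "(\<lambda>w. \<Sum>b. a b * w powi e b) holomorphic_on ball 0 1 - {0}"
proof (rule holomorphic_uniform_sequence[where f = "\<lambda>n w. \<Sum>b<n. a b * w powi e b"])
  show "open (ball (0::complex) 1 - {0})" by auto
  show "(\<lambda>w. \<Sum>b<n. a b * w powi e b) holomorphic_on ball 0 1 - {0}" for n
    by (auto intro!: holomorphic_intros)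
  fix x :: complex assume x: "x \<in> ball 0 1 - {0}"
  define d where "d = min (cmod x / 2) ((1 - cmod x) / 2)"
  define r1 r2 where "r1 = cmod x / 2" and "r2 = (1 + cmod x) / 2"
  have r: "0 < r1" "r1 < 1" "0 < r2" "r2 < 1" "d > 0" using x by (auto simp: r1_def r2_def d_def add_pos_nonneg)
  have in_annulus: "r1 \<le> cmod w \<and> cmod w \<le> r2" if "w \<in> cball x d" for w
  proof -
    have "\<bar>cmod w - cmod x\<bar> \<le> d" using that norm_triangle_ineq3[of w x] by (simp add: dist_norm norm_minus_commute)
    moreover have "d \<le> cmod x / 2" "d \<le> (1 - cmod x) / 2"
      by (simp_all only: d_def min.cobounded1 min.cobounded2)
    ultimately show ?thesis unfolding r1_def r2_def by (intro conjI; simp add: field_simps; linarith)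
  qed
  have "cball x d \<subseteq> ball 0 1 - {0}"
  proof
    fix w assume "w \<in> cball x d"
    with in_annulus[of w] r show "w \<in> ball 0 1 - {0}" by auto
  qed
  moreover have "uniform_limit (cball x d) (\<lambda>n w. \<Sum>b<n. a b * w powi e b) (\<lambda>w. \<Sum>b. a b * w powi e b) sequentially"
  proof (rule Weierstrass_m_test)
    show "summable (\<lambda>b. cmod (a b) * r1 powi e b + cmod (a b) * r2 powi e b)"
      by (intro summable_add sm r)
    fix b w assume "w \<in> cball x d"
    then have "cmod w powi e b \<le> r1 powi e b + r2 powi e b"
      using in_annulus r by (intro power_int_le_sum_endpoints) auto
    then have "cmod (a b) * cmod w powi e b \<le> cmod (a b) * (r1 powi e b + r2 powi e b)"
      by (rule mult_left_mono) simp
    then show "norm (a b * w powi e b) \<le> cmod (a b) * r1 powi e b + cmod (a b) * r2 powi e b"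
      by (simp add: norm_mult norm_power_int distrib_left)
  qed
  ultimately show "\<exists>d>0. cball x d \<subseteq> ball 0 1 - {0} \<and>
      uniform_limit (cball x d) (\<lambda>n w. \<Sum>b<n. a b * w powi e b) (\<lambda>w. \<Sum>b. a b * w powi e b) sequentially"
    using r by blast
qed

text \<open>
  Square integrability is the triangle inequality in \<open>L\<^sup>2\<close> for an infinite sum, obtained pointwise:
  Cauchy-Schwarz with weights \<open>sqrt (moment (e b))\<close> bounds the square of the modulus by a constant
  times a series whose \<open>b\<close>-th term has integral \<open>cmod (a b) * sqrt (moment (e b))\<close>.
\<close>
lemma monomial_series_in_bergman_space:
  assumes sm: "summable (\<lambda>b. cmod (a b) * sqrt (moment (e b)))"
  shows "monomial_series a e \<in> bergman_space \<Omega>"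
proof -
  let ?\<phi> = "\<lambda>w. \<Sum>b. a b * w powi e b"
  have hol: "holomorphic_several (monomial_series a e) \<Omega>"
  proof (rule holomorphic_several_cong_open[OF _ open_hartogs])
    show "holomorphic_several (\<lambda>z::complex^2. ?\<phi> (z $ 2)) \<Omega>"
      by (rule holomorphic_several_component[OF holomorphic_monomial_series])
         (auto simp: mem_hartogs intro: summable_monomial_coefficients[OF sm])
  qed (simp add: monomial_series_def)
  have cont: "continuous_on \<Omega> (monomial_series a e)"
    by (rule holomorphic_several_imp_continuous_on[OF hol])
  define A where "A = (\<Sum>b. cmod (a b) * sqrt (moment (e b)))"
  define Q where "Q = (\<lambda>b (z::complex^2). cmod (a b) * (cmod (z $ 2) powi e b)\<^sup>2 / sqrt (moment (e b)))"
  have Qnn: "0 \<le> Q b z" for b z using moment_pos[of "e b"] by (simp add: Q_def)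
  have Qint: "integrable (lebesgue_on \<Omega>) (Q b)" for b
    unfolding Q_def by (intro integrable_divide integrable_mult_right integrable_moment)
  have "integrable (lebesgue_on \<Omega>) (\<lambda>z. \<Sum>b. Q b z)"
  proof (rule integrable_suminf[OF Qint])
    show "AE z in lebesgue_on \<Omega>. summable (\<lambda>b. norm (Q b z))"
    proof (rule AE_I2)
      fix z assume "z \<in> space (lebesgue_on \<Omega>)"
      then have "summable (\<lambda>b. Q b z)"
        unfolding Q_def by (intro summable_monomial_coefficients(2)[OF sm]) (auto simp: mem_hartogs)
      then show "summable (\<lambda>b. norm (Q b z))" using Qnn by simp
    qed
    have "(\<integral>z. norm (Q b z) \<partial>lebesgue_on \<Omega>) = cmod (a b) * sqrt (moment (e b))" for b
    proof -
      have "(\<integral>z. norm (Q b z) \<partial>lebesgue_on \<Omega>) = cmod (a b) * (moment (e b) / sqrt (moment (e b)))"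
        using Qnn by (simp add: Q_def moment_def)
      then show ?thesis using moment_pos[of "e b"] by (simp only: real_div_sqrt less_imp_le)
    qed
    then show "summable (\<lambda>b. \<integral>z. norm (Q b z) \<partial>lebesgue_on \<Omega>)" using sm by simp
  qed
  then have iAQ: "integrable (lebesgue_on \<Omega>) (\<lambda>z. A * (\<Sum>b. Q b z))" by simp
  have le: "(cmod (monomial_series a e z))\<^sup>2 \<le> A * (\<Sum>b. Q b z)" if z: "z \<in> \<Omega>" for z
  proof -
    have \<rho>: "0 < cmod (z $ 2)" "cmod (z $ 2) < 1" using z by (auto simp: mem_hartogs)
    note sums = summable_monomial_coefficients[OF sm \<rho>]
    have "cmod (monomial_series a e z) \<le> (\<Sum>b. cmod (a b) * cmod (z $ 2) powi e b)"
      using z sums(1) summable_norm[of "\<lambda>b. a b * (z $ 2) powi e b"]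
      by (simp add: monomial_series_def norm_mult norm_power_int)
    then have "(cmod (monomial_series a e z))\<^sup>2 \<le> (\<Sum>b. cmod (a b) * cmod (z $ 2) powi e b)\<^sup>2"
      by (rule power_mono) simp
    also have "\<dots> \<le> A * (\<Sum>b. Q b z)"
      unfolding A_def Q_def
      by (rule suminf_weighted_Cauchy_Schwarz) (use sums sm moment_pos in auto)
    finally show ?thesis .
  qed
  have m: "monomial_series a e \<in> borel_measurable (lebesgue_on \<Omega>)"
    by (rule continuous_imp_measurable_on_sets_lebesgue[OF cont]) simp
  have "integrable (lebesgue_on \<Omega>) (\<lambda>z. (cmod (monomial_series a e z))\<^sup>2)"
  proof (rule Bochner_Integration.integrable_bound[OF iAQ])
    show "(\<lambda>z. (cmod (monomial_series a e z))\<^sup>2) \<in> borel_measurable (lebesgue_on \<Omega>)" using m by measurable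
    show "AE z in lebesgue_on \<Omega>. norm ((cmod (monomial_series a e z))\<^sup>2) \<le> norm (A * (\<Sum>b. Q b z))"
      using le by (intro AE_I2) (auto intro: order_trans[OF _ abs_ge_self])
  qed
  then show ?thesis using hol m by (simp add: bergman_space_def L2_space_iff)
qed

lemma integral_monomial_series_mult:
  assumes sm: "summable (\<lambda>b. cmod (a b) * sqrt (moment (e b)))" and k: "k \<in> L2_space \<Omega>"
  shows "(\<lambda>b. a b * (\<integral>z. (z $ 2) powi e b * k z \<partial>lebesgue_on \<Omega>))
     sums (\<integral>z. monomial_series a e z * k z \<partial>lebesgue_on \<Omega>)"
proof -
  let ?f = "\<lambda>b (z::complex^2). a b * ((z $ 2) powi e b * k z)"
  define K where "K = (\<integral>z. (cmod (k z))\<^sup>2 \<partial>lebesgue_on \<Omega>)"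
  have k2: "integrable (lebesgue_on \<Omega>) (\<lambda>z. (cmod (k z))\<^sup>2)" using k by (simp add: L2_space_iff)
  have int: "integrable (lebesgue_on \<Omega>) (\<lambda>z. (z $ 2) powi n * k z)" for n
    by (intro L2_space_mult_integrable monomial_in_L2 k)
  have smz: "summable (\<lambda>b. norm (a b * (z $ 2) powi e b))" if "z \<in> \<Omega>" for z
    using summable_monomial_coefficients(1)[OF sm, of "cmod (z $ 2)"] that
    by (simp add: norm_mult norm_power_int mem_hartogs)
  have "(\<lambda>b. \<integral>z. ?f b z \<partial>lebesgue_on \<Omega>) sums (\<integral>z. (\<Sum>b. ?f b z) \<partial>lebesgue_on \<Omega>)"
  proof (rule sums_integral)
    show "integrable (lebesgue_on \<Omega>) (?f b)" for b by (intro integrable_mult_right int)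
    show "AE z in lebesgue_on \<Omega>. summable (\<lambda>b. norm (?f b z))"
      using summable_mult2[OF smz] by (intro AE_I2) (simp add: norm_mult mult.assoc)
    have "(\<integral>z. norm (?f b z) \<partial>lebesgue_on \<Omega>) \<le> (cmod (a b) * sqrt (moment (e b))) * ((1 + K) / 2)" for b
    proof -
      let ?s = "sqrt (moment (e b))"
      have s: "?s > 0" using moment_pos by simp
      have "(\<integral>z. norm ((z $ 2) powi e b * k z) \<partial>lebesgue_on \<Omega>)
          \<le> (\<integral>z. ((cmod (z $ 2) powi e b)\<^sup>2 / ?s + ?s * (cmod (k z))\<^sup>2) / 2 \<partial>lebesgue_on \<Omega>)"
      proof (rule Bochner_Integration.integral_mono)
        show "integrable (lebesgue_on \<Omega>) (\<lambda>z. norm ((z $ 2) powi e b * k z))" by (rule integrable_norm[OF int])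
        show "integrable (lebesgue_on \<Omega>) (\<lambda>z. ((cmod (z $ 2) powi e b)\<^sup>2 / ?s + ?s * (cmod (k z))\<^sup>2) / 2)"
          by (intro integrable_divide Bochner_Integration.integrable_add integrable_mult_right integrable_moment k2)
        fix z :: "complex^2"
        let ?x = "cmod (z $ 2) powi e b" and ?y = "cmod (k z)"
        \<comment> \<open>Young's inequality, balanced by \<open>?s\<close> so that both parts integrate to a multiple of \<open>?s\<close>.\<close>
        have "2 * (?x * ?y) * ?s \<le> ?x\<^sup>2 + (?s * ?y)\<^sup>2"
          using sum_squares_bound[of ?x "?s * ?y"] by (simp add: mult_ac)
        then have "?x * ?y \<le> (?x\<^sup>2 / ?s + ?s * ?y\<^sup>2) / 2"
          using s by (simp add: field_simps power2_eq_square)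
        then show "norm ((z $ 2) powi e b * k z) \<le> (?x\<^sup>2 / ?s + ?s * ?y\<^sup>2) / 2"
          by (simp add: norm_mult norm_power_int)
      qed
      also have "\<dots> = (moment (e b) / ?s + ?s * K) / 2"
        unfolding moment_def K_def
        by (subst integral_divide_zero, subst Bochner_Integration.integral_add)
           (auto intro!: integrable_divide integrable_moment integrable_mult_right k2)
      also have "moment (e b) / ?s = ?s" using moment_pos[of "e b"] by (simp add: real_div_sqrt)
      finally have "(\<integral>z. norm ((z $ 2) powi e b * k z) \<partial>lebesgue_on \<Omega>) \<le> ?s * ((1 + K) / 2)"
        by (simp add: algebra_simps)
      then have "cmod (a b) * (\<integral>z. norm ((z $ 2) powi e b * k z) \<partial>lebesgue_on \<Omega>) \<le> cmod (a b) * (?s * ((1 + K) / 2))"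
        by (rule mult_left_mono) simp
      then show ?thesis by (simp add: norm_mult mult.assoc)
    qed
    then show "summable (\<lambda>b. \<integral>z. norm (?f b z) \<partial>lebesgue_on \<Omega>)"
      by (intro summable_comparison_test'[OF summable_mult2[OF sm, of "(1 + K) / 2"], of 0]) auto
  qed
  also have "(\<integral>z. (\<Sum>b. ?f b z) \<partial>lebesgue_on \<Omega>) = (\<integral>z. monomial_series a e z * k z \<partial>lebesgue_on \<Omega>)"
  proof (rule Bochner_Integration.integral_cong[OF refl])
    fix z assume "z \<in> space (lebesgue_on \<Omega>)"
    then have z: "z \<in> \<Omega>" by simp
    show "(\<Sum>b. ?f b z) = monomial_series a e z * k z"
      using suminf_mult2[OF summable_norm_cancel[OF smz[OF z]], of "k z"] z
      by (simp add: monomial_series_def mult.assoc)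
  qed
  finally show ?thesis by simp
qed

text \<open>
  The hypothesis \<open>pairing\<close> says that \<open>f\<close> acts on the Bergman space like the (possibly only
  formal) sum of \<open>\<beta> b\<close> times the conjugate of \<open>w\<close> to the power \<open>- e b\<close>. Each such conjugate
  projects to a multiple of \<open>w\<close> to the power \<open>e b\<close>, with the ratio of moments as factor. Both
  applications of the Friedrichs operator are instances: \<open>e b = - b\<close> for the first,
  \<open>e b = b\<close> for the second.
\<close>
lemma bergman_projection_eq_monomial_series:
  assumes f: "f \<in> L2_space \<Omega>"
    and pairing: "\<And>k. k \<in> bergman_space \<Omega> \<Longrightarrow>
      (\<lambda>b. \<beta> b * cnj (\<integral>z. (z $ 2) powi (- e b) * k z \<partial>lebesgue_on \<Omega>))
        sums (\<integral>z. f z * cnj (k z) \<partial>lebesgue_on \<Omega>)"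
    and a: "\<And>b. a b = \<beta> b * of_real (moment 0 / moment (e b))"
    and sm: "summable (\<lambda>b. cmod (a b) * sqrt (moment (e b)))"
  shows "bergman_projection \<Omega> f = monomial_series a e"
proof (rule bergman_projection_eqI[OF open_hartogs f monomial_series_in_bergman_space[OF sm]])
  show "z \<notin> \<Omega> \<Longrightarrow> monomial_series a e z = 0" for z by (simp add: monomial_series_def)
  fix k assume k: "k \<in> bergman_space \<Omega>"
  then have L2: "(\<lambda>z. cnj (k z)) \<in> L2_space \<Omega>" by (auto simp: bergman_space_def intro: L2_space_cnj)
  have "a b * (\<integral>z. (z $ 2) powi e b * cnj (k z) \<partial>lebesgue_on \<Omega>)
      = \<beta> b * cnj (\<integral>z. (z $ 2) powi (- e b) * k z \<partial>lebesgue_on \<Omega>)" for b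
  proof -
    have nz: "moment (e b) \<noteq> 0" "moment 0 \<noteq> 0" using moment_pos by (metis less_irrefl)+
    have "(\<integral>z. (z $ 2) powi e b * cnj (k z) \<partial>lebesgue_on \<Omega>) =
        cnj (\<integral>z. cnj ((z $ 2) powi e b) * k z \<partial>lebesgue_on \<Omega>)"
      by (subst Bochner_Integration.integral_cnj[symmetric]) simp
    moreover have "cnj (of_real (moment 0) * (\<integral>z. cnj ((z $ 2) powi e b) * k z \<partial>lebesgue_on \<Omega>))
       = cnj (of_real (moment (e b)) * (\<integral>z. (z $ 2) powi (- e b) * k z \<partial>lebesgue_on \<Omega>))"
      by (simp only: integral_cnj_monomial_mult[OF k])
    ultimately have "of_real (moment 0) * (\<integral>z. (z $ 2) powi e b * cnj (k z) \<partial>lebesgue_on \<Omega>)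
       = of_real (moment (e b)) * cnj (\<integral>z. (z $ 2) powi (- e b) * k z \<partial>lebesgue_on \<Omega>)"
      by (simp only: complex_cnj_mult complex_cnj_complex_of_real)
    then show ?thesis unfolding a using nz by (simp add: field_simps)
  qed
  then have "(\<lambda>b. \<beta> b * cnj (\<integral>z. (z $ 2) powi (- e b) * k z \<partial>lebesgue_on \<Omega>))
      sums (\<integral>z. monomial_series a e z * cnj (k z) \<partial>lebesgue_on \<Omega>)"
    using integral_monomial_series_mult[OF sm L2] by simp
  then have "(\<integral>z. f z * cnj (k z) \<partial>lebesgue_on \<Omega>) = (\<integral>z. monomial_series a e z * cnj (k z) \<partial>lebesgue_on \<Omega>)"
    using pairing[OF k] sums_unique2 by blast
  moreover have "L2_inner \<Omega> (\<lambda>z. f z - monomial_series a e z) k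
      = (\<integral>z. f z * cnj (k z) \<partial>lebesgue_on \<Omega>) - (\<integral>z. monomial_series a e z * cnj (k z) \<partial>lebesgue_on \<Omega>)"
    unfolding L2_inner_def left_diff_distrib
    using monomial_series_in_bergman_space[OF sm]
    by (intro Bochner_Integration.integral_diff L2_space_mult_integrable f L2) (simp add: bergman_space_def)
  ultimately show "L2_inner \<Omega> (\<lambda>z. f z - monomial_series a e z) k = 0" by simp
qed

section \<open>The square of the Friedrichs operator\<close>

lemma moment_nat_le: "moment (int b) \<le> moment 0"
  unfolding moment_def
proof (rule integral_mono_AE[OF integrable_moment integrable_moment])
  show "AE z in lebesgue_on \<Omega>. (cmod (z $ 2) powi int b)\<^sup>2 \<le> (cmod (z $ 2) powi 0)\<^sup>2"
    by (intro AE_I2) (auto simp: mem_hartogs power_le_one)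
qed

text \<open>
  The case \<open>\<rho> = 1 / 4\<close> of the lower bound, chosen small enough for both series below: the
  first needs \<open>\<rho> < 1 / 2\<close>, the second \<open>\<rho>\<^sup>2 < 1 / 8\<close>.
\<close>
lemma moment_negative_lower_bound:
  obtains v where "v > 0" "\<And>b. v * 16 ^ b \<le> moment (- int b)"
proof -
  obtain v where v: "v > 0" "\<And>n. v * ((1/4) powi n)\<^sup>2 \<le> moment n"
    using moment_lower_bound[of "1/4"] by auto
  have "((1/4 :: real) powi (- int b))\<^sup>2 = 16 ^ b" for b
    by (simp add: power_int_minus power_divide power2_eq_square flip: power_mult_distrib)
  with v that show ?thesis by metis
qed

lemma summable_over_sqrt_moment: "summable (\<lambda>b. 2 ^ b / sqrt (moment (- int b)))"
proof -
  obtain v where v: "v > 0" "\<And>b. v * 16 ^ b \<le> moment (- int b)"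
    using moment_negative_lower_bound by blast
  show ?thesis
  proof (rule summable_comparison_test'[where N = 0])
    show "summable (\<lambda>b. (1 / sqrt v) * (1 / 2) ^ b)" by (intro summable_mult summable_geometric) simp
    fix b
    have "sqrt ((16::real) ^ b) = 4 ^ b"
      by (rule real_sqrt_unique) (simp_all add: power2_eq_square flip: power_mult_distrib)
    then have "sqrt v * 4 ^ b \<le> sqrt (moment (- int b))"
      using real_sqrt_le_mono[OF v(2)[of b]] by (simp add: real_sqrt_mult)
    then have "2 ^ b / sqrt (moment (- int b)) \<le> 2 ^ b / (sqrt v * 4 ^ b)"
      using v(1) by (intro divide_left_mono) (auto intro!: mult_pos_pos simp: moment_pos)
    also have "(4 :: real) ^ b = 2 ^ b * 2 ^ b" by (simp flip: power_mult_distrib)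
    finally show "norm (2 ^ b / sqrt (moment (- int b))) \<le> (1 / sqrt v) * (1 / 2) ^ b"
      using less_imp_le[OF moment_pos[of "- int b"]] by (simp add: power_divide)
  qed
qed

text \<open>
  With \<open>\<rho> = 1 / 4\<close> for the negative index and \<open>\<rho> = 1 / 2\<close> for the positive one the terms are at
  most a constant times \<open>2\<^sup>b * 16\<^sup>-\<^sup>b * 4\<^sup>b = 2\<^sup>-\<^sup>b\<close>. The same \<open>\<rho>\<close> for both would cancel.
\<close>
lemma summable_over_moment_product:
  "summable (\<lambda>b. 2 ^ b / (moment (- int b) * moment (int b)))"
proof -
  obtain v where v: "v > 0" "\<And>b. v * 16 ^ b \<le> moment (- int b)"
    using moment_negative_lower_bound by blast
  obtain u where u: "u > 0" "\<And>n. u * ((1/2) powi n)\<^sup>2 \<le> moment n"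
    using moment_lower_bound[of "1/2"] by auto
  show ?thesis
  proof (rule summable_comparison_test'[where N = 0])
    show "summable (\<lambda>b. (1 / (v * u)) * (1 / 2) ^ b)" by (intro summable_mult summable_geometric) simp
    fix b
    have four: "(4 :: real) ^ b = 2 ^ b * 2 ^ b" "(16 :: real) ^ b = 2 ^ b * 2 ^ b * 2 ^ b * 2 ^ b"
      by (simp_all flip: power_mult_distrib)
    have "((1/2 :: real) powi int b)\<^sup>2 = 1 / 4 ^ b"
      by (simp add: power_divide power2_eq_square four)
    then have "u / 4 ^ b \<le> moment (int b)" using u(2)[of "int b"] by simp
    then have "(v * 16 ^ b) * (u / 4 ^ b) \<le> moment (- int b) * moment (int b)"
      using v u less_imp_le[OF moment_pos] by (intro mult_mono) auto
    then have "2 ^ b / (moment (- int b) * moment (int b)) \<le> 2 ^ b / ((v * 16 ^ b) * (u / 4 ^ b))"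
      using v(1) u(1) by (intro divide_left_mono) (auto intro!: mult_pos_pos simp: moment_pos)
    also have "\<dots> = (1 / (v * u)) * (1 / 2) ^ b"
      using v(1) u(1) by (simp add: four field_simps)
    finally show "norm (2 ^ b / (moment (- int b) * moment (int b))) \<le> (1 / (v * u)) * (1 / 2) ^ b"
      using less_imp_le[OF moment_pos[of "- int b"]] less_imp_le[OF moment_pos[of "int b"]] by simp
  qed
qed

text \<open>
  The factor by which the square of the Friedrichs operator multiplies \<open>w\<^sup>b\<close>.
\<close>
definition multiplier :: "nat \<Rightarrow> real" where
  "multiplier b = (moment 0)\<^sup>2 / (moment (- int b) * moment (int b))"

lemma multiplier_nonneg: "multiplier b \<ge> 0"
  using less_imp_le[OF moment_pos] by (simp add: multiplier_def)

lemma summable_multiplier: "summable (\<lambda>b. 2 ^ b * multiplier b)"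
  using summable_mult[OF summable_over_moment_product, of "(moment 0)\<^sup>2"]
  by (simp add: multiplier_def mult_ac)

text \<open>
  The coefficients \<open>\<gamma>\<close> are those of \<open>g\<close> on the axis. The first application pairs through
  \<open>integral_mult_axis_power_series\<close>; its result is a series in \<open>1 / w\<close> that converges in \<open>L\<^sup>2\<close>, so the
  second application can integrate term by term.
\<close>
lemma friedrichs_square_eq:
  assumes g: "g \<in> H_infinity \<Omega>" and B: "\<And>z. z \<in> \<Omega> \<Longrightarrow> cmod (g z) \<le> B"
  obtains \<gamma> where "\<And>b. cmod (\<gamma> b) \<le> B * 2 ^ b"
    and "summable (\<lambda>b. cmod (\<gamma> b * of_real (multiplier b)) * sqrt (moment (int b)))"
    and "friedrichs_operator \<Omega> (friedrichs_operator \<Omega> g)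
       = monomial_series (\<lambda>b. \<gamma> b * of_real (multiplier b)) int"
proof -
  have gb: "g \<in> bergman_space \<Omega>" using g H_infinity_subset_bergman_space by blast
  then have hol: "holomorphic_several g \<Omega>" and L2: "g \<in> L2_space \<Omega>" by (auto simp: bergman_space_def)
  obtain \<gamma> where ser: "\<And>w. 0 < cmod w \<Longrightarrow> cmod w < 1 \<Longrightarrow> (\<lambda>b. \<gamma> b * w ^ b) sums g (pt 0 w)"
    and \<gamma>: "\<And>b. cmod (\<gamma> b) \<le> B * 2 ^ b"
    using H_infinity_axis_power_series[OF hol B] by blast
  have B0: "B \<ge> 0" using order_trans[OF norm_ge_zero \<gamma>[of 0]] by simp
  define a where "a = (\<lambda>b. cnj (\<gamma> b) * of_real (moment 0 / moment (- int b)))"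
  have sa: "summable (\<lambda>b. cmod (a b) * sqrt (moment (- int b)))"
  proof (rule summable_comparison_test'[where N = 0])
    show "summable (\<lambda>b. (B * moment 0) * (2 ^ b / sqrt (moment (- int b))))"
      by (intro summable_mult summable_over_sqrt_moment)
    fix b
    let ?m = "moment (- int b)"
    have m: "?m > 0" "moment 0 > 0" by (simp_all add: moment_pos)
    have "norm (cmod (a b) * sqrt ?m) = cmod (\<gamma> b) * moment 0 * (sqrt ?m / ?m)"
      using m by (simp add: a_def norm_mult norm_divide)
    also have "sqrt ?m / ?m = 1 / sqrt ?m" using m by (simp add: field_simps)
    also have "cmod (\<gamma> b) * moment 0 * (1 / sqrt ?m) \<le> (B * 2 ^ b) * moment 0 * (1 / sqrt ?m)"
      using m by (intro mult_right_mono \<gamma>) auto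
    finally show "norm (cmod (a b) * sqrt ?m) \<le> (B * moment 0) * (2 ^ b / sqrt ?m)"
      by (simp add: mult_ac)
  qed
  have F1: "friedrichs_operator \<Omega> g = monomial_series a (\<lambda>b. - int b)"
    unfolding friedrichs_operator_def
  proof (rule bergman_projection_eq_monomial_series[where \<beta> = "\<lambda>b. cnj (\<gamma> b)", OF L2_space_cnj[OF L2] _ _ sa])
    fix k assume k: "k \<in> bergman_space \<Omega>"
    then have kL2: "k \<in> L2_space \<Omega>" by (simp add: bergman_space_def)
    have "(\<lambda>b. \<gamma> b * (\<integral>z. (z $ 2) powi int b * k z \<partial>lebesgue_on \<Omega>)) sums (\<integral>z. g z * k z \<partial>lebesgue_on \<Omega>)"
      by (rule integral_mult_axis_power_series[OF hol k L2_space_mult_integrable[OF L2 kL2] ser \<gamma>])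
    then have "(\<lambda>b. cnj (\<gamma> b * (\<integral>z. (z $ 2) powi int b * k z \<partial>lebesgue_on \<Omega>)))
        sums cnj (\<integral>z. g z * k z \<partial>lebesgue_on \<Omega>)"
      by (simp only: sums_cnj)
    then show "(\<lambda>b. cnj (\<gamma> b) * cnj (\<integral>z. (z $ 2) powi (- (- int b)) * k z \<partial>lebesgue_on \<Omega>))
        sums (\<integral>z. cnj (g z) * cnj (k z) \<partial>lebesgue_on \<Omega>)"
      by (simp flip: Bochner_Integration.integral_cnj)
  qed (simp add: a_def)
  have a2: "\<gamma> b * of_real (multiplier b) = cnj (a b) * of_real (moment 0 / moment (int b))" for b
    by (simp add: a_def multiplier_def power2_eq_square)
  have s2: "summable (\<lambda>b. cmod (\<gamma> b * of_real (multiplier b)) * sqrt (moment (int b)))"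
  proof (rule summable_comparison_test'[where N = 0])
    show "summable (\<lambda>b. (B * sqrt (moment 0)) * (2 ^ b * multiplier b))"
      by (intro summable_mult summable_multiplier)
    fix b
    have "cmod (\<gamma> b * of_real (multiplier b)) * sqrt (moment (int b))
        \<le> (B * 2 ^ b * multiplier b) * sqrt (moment 0)"
      using B0 multiplier_nonneg[of b] less_imp_le[OF moment_pos]
      by (intro mult_mono real_sqrt_le_mono moment_nat_le) (auto simp: norm_mult intro!: mult_right_mono \<gamma>)
    then show "norm (cmod (\<gamma> b * of_real (multiplier b)) * sqrt (moment (int b)))
        \<le> (B * sqrt (moment 0)) * (2 ^ b * multiplier b)"
      using less_imp_le[OF moment_pos[of "int b"]] by (simp add: abs_mult mult_ac)
  qed
  have h: "monomial_series a (\<lambda>b. - int b) \<in> L2_space \<Omega>"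
    using monomial_series_in_bergman_space[OF sa] by (simp add: bergman_space_def)
  have "friedrichs_operator \<Omega> (monomial_series a (\<lambda>b. - int b))
       = monomial_series (\<lambda>b. \<gamma> b * of_real (multiplier b)) int"
    unfolding friedrichs_operator_def
  proof (rule bergman_projection_eq_monomial_series[where \<beta> = "\<lambda>b. cnj (a b)", OF L2_space_cnj[OF h] _ a2 s2])
    fix k assume "k \<in> bergman_space \<Omega>"
    then have kL2: "k \<in> L2_space \<Omega>" by (simp add: bergman_space_def)
    have "(\<lambda>b. cnj (a b * (\<integral>z. (z $ 2) powi (- int b) * k z \<partial>lebesgue_on \<Omega>)))
        sums cnj (\<integral>z. monomial_series a (\<lambda>b. - int b) z * k z \<partial>lebesgue_on \<Omega>)"
      using integral_monomial_series_mult[OF sa kL2] by (simp only: sums_cnj)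
    then show "(\<lambda>b. cnj (a b) * cnj (\<integral>z. (z $ 2) powi (- int b) * k z \<partial>lebesgue_on \<Omega>))
        sums (\<integral>z. cnj (monomial_series a (\<lambda>b. - int b) z) * cnj (k z) \<partial>lebesgue_on \<Omega>)"
      by (simp flip: Bochner_Integration.integral_cnj)
  qed
  then show ?thesis using that[OF \<gamma> s2] F1 by simp
qed

lemma monomial_series_bound:
  assumes "\<And>b. cmod (a b) \<le> c b" "summable c" "z \<in> \<Omega>"
  shows "cmod (monomial_series a int z) \<le> suminf c"
proof -
  have le: "norm (a b * (z $ 2) powi int b) \<le> c b" for b
  proof -
    have "norm (a b * (z $ 2) powi int b) \<le> cmod (a b) * 1"
      using assms(3) by (auto simp: norm_mult norm_power mem_hartogs intro!: mult_left_le power_le_one)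
    then show ?thesis using assms(1)[of b] by simp
  qed
  then show ?thesis
    using norm_suminf_le[of "\<lambda>b. a b * (z $ 2) powi int b" c] assms(2,3)
    by (simp add: monomial_series_def)
qed

theorem proposition3p14:
  "bounded_operator
     (H_infinity exponential_hartogs_triangle) (sup_norm exponential_hartogs_triangle)
     (H_infinity exponential_hartogs_triangle) (sup_norm exponential_hartogs_triangle)
     (friedrichs_operator exponential_hartogs_triangle \<circ>
      friedrichs_operator exponential_hartogs_triangle)"
proof -
  define C where "C = (\<Sum>b. 2 ^ b * multiplier b)"
  have main: "(friedrichs_operator \<Omega> \<circ> friedrichs_operator \<Omega>) g \<in> H_infinity \<Omega> \<and>
      sup_norm \<Omega> ((friedrichs_operator \<Omega> \<circ> friedrichs_operator \<Omega>) g) \<le> C * sup_norm \<Omega> g"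
    if g: "g \<in> H_infinity \<Omega>" for g
  proof -
    let ?F = "(friedrichs_operator \<Omega> \<circ> friedrichs_operator \<Omega>) g"
    have "bdd_above ((\<lambda>z. cmod (g z)) ` \<Omega>)"
      using g by (auto simp: H_infinity_def bounded_iff bdd_above_def)
    then have B: "cmod (g z) \<le> sup_norm \<Omega> g" if "z \<in> \<Omega>" for z
      unfolding sup_norm_def using that by (rule cSUP_upper[rotated])
    obtain \<gamma> where \<gamma>: "\<And>b. cmod (\<gamma> b) \<le> sup_norm \<Omega> g * 2 ^ b"
      and s: "summable (\<lambda>b. cmod (\<gamma> b * of_real (multiplier b)) * sqrt (moment (int b)))"
      and F: "friedrichs_operator \<Omega> (friedrichs_operator \<Omega> g)
         = monomial_series (\<lambda>b. \<gamma> b * of_real (multiplier b)) int"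
      using friedrichs_square_eq[OF g B] by blast
    have "cmod (?F z) \<le> C * sup_norm \<Omega> g" if "z \<in> \<Omega>" for z
    proof -
      have "cmod (\<gamma> b * of_real (multiplier b)) \<le> sup_norm \<Omega> g * (2 ^ b * multiplier b)" for b
        using mult_right_mono[OF \<gamma> multiplier_nonneg, of b b] multiplier_nonneg[of b]
        by (simp add: norm_mult mult.assoc)
      then have "cmod (?F z) \<le> (\<Sum>b. sup_norm \<Omega> g * (2 ^ b * multiplier b))"
        unfolding o_def F by (rule monomial_series_bound) (intro summable_mult summable_multiplier that)+
      also have "\<dots> = C * sup_norm \<Omega> g"
        unfolding C_def by (subst suminf_mult[OF summable_multiplier]) (rule mult.commute)
      finally show ?thesis .
    qed
    moreover have "?F \<in> bergman_space \<Omega>"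
      unfolding o_def F by (rule monomial_series_in_bergman_space[OF s])
    moreover have "pt 0 (1 / 2) \<in> \<Omega>" by (rule hartogs_axis) (simp_all add: norm_divide)
    ultimately show ?thesis
      by (auto simp: H_infinity_def bergman_space_def bounded_iff sup_norm_def intro!: cSUP_least)
  qed
  then show ?thesis unfolding bounded_operator_def by blast
qed

end
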